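(* Let $w$ be a positive integer. Any natural inglenook puzzle with $w$ wagons that can always be solved can be solved, from any starting position, in at most $2w^2+12w-10$ moves. Moreover, there are natural inglenook puzzles with $w$ wagons having starting positions that require at least $(w^2-1)/2$ moves to solve.
   Context: Inglenook puzzle: for positive integers $w,s,h,m_1,\ldots,m_s$ with $w<h+m_1+\cdots+m_s$, there are $s$ sidings of lengths $m_1,\ldots,m_s$, a headshunt of length $h$, and a set $W$ of $w$ wagons. A position is a tuple $(W_0,W_1,\ldots,W_s)$ of ordered subsets of $W$ that partition $W$, with $|W_0|\le h$ and $|W_i|\le m_i$ for $1\le i\le s$ ($W_0$ lists headshunt wagons from shunting engine to points; $W_i$ lists the wagons of Siding $i$ from points to buffer stop). A move is a pair of distinct positions $(W_0,\ldots,W_s)$, $(W_0',\ldots,W_s')$ such that for some $r\in\{1,\ldots,s\}$, $W_i=W_i'$ for all $i\in\{1,\ldots,s\}\setminus\{r\}$, and the concatenation of $W_0$ then $W_r$ equals the concatenation of $W_0'$ then $W_r'$. The inglenook graph has positions as vertices and moves as edges. A puzzle is given by a set $S$ of starting positions and a set $F$ of finishing positions; solving it from $p\in S$ means finding a path in the inglenook graph from $p$ to a position of $F$, and the puzzle can always be solved if this is possible for every $p\in S$. The puzzle is natural if $S$ is closed under permuting wagons (applying any bijection $W\to W$ to a position in $S$ gives a position in $S$), and there exist $z\in\{1,\ldots,s\}$ and $\omega\in W$ such that every finishing position has $\omega$ as the last entry of $W_z$. *)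

theory Defs
  imports Complex_Main
begin

text \<open>
  A position \<open>(W\<^sub>0, W\<^sub>1, \<dots>, W\<^sub>s)\<close> is the list \<open>[W\<^sub>0, W\<^sub>1, \<dots>, W\<^sub>s]\<close>.  The head of
  \<open>W\<^sub>0\<close> is the wagon nearest the engine; for \<open>i \<ge> 1\<close> the head of \<open>W\<^sub>i\<close> is the wagon of
  siding \<open>i\<close> nearest the points, and its last entry the one nearest the buffer stop.
\<close>

type_synonym 'a position = "'a list list"

text \<open>Only the values of \<open>siding_length\<close> on \<open>{1..num_sidings}\<close> matter.\<close>

record 'a puzzle =
  num_sidings :: nat
  headshunt_length :: nat
  siding_length :: "nat \<Rightarrow> nat"
  wagons :: "'a set"
  starts :: "'a position set"
  finishes :: "'a position set"

definition positions :: "'a puzzle \<Rightarrow> 'a position set" where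
  "positions P = {p. length p = num_sidings P + 1 \<and>
     distinct (concat p) \<and> set (concat p) = wagons P \<and>
     length (p ! 0) \<le> headshunt_length P \<and>
     (\<forall>i\<in>{1..num_sidings P}. length (p ! i) \<le> siding_length P i)}"

definition inglenook_puzzle :: "'a puzzle \<Rightarrow> bool" where
  "inglenook_puzzle P \<longleftrightarrow>
     num_sidings P > 0 \<and> headshunt_length P > 0 \<and>
     (\<forall>i\<in>{1..num_sidings P}. siding_length P i > 0) \<and>
     finite (wagons P) \<and> card (wagons P) > 0 \<and>
     card (wagons P) < headshunt_length P + (\<Sum>i=1..num_sidings P. siding_length P i) \<and>
     starts P \<subseteq> positions P \<and> finishes P \<subseteq> positions P"

definition move :: "'a puzzle \<Rightarrow> 'a position \<Rightarrow> 'a position \<Rightarrow> bool" where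
  "move P p q \<longleftrightarrow> p \<in> positions P \<and> q \<in> positions P \<and> p \<noteq> q \<and>
     (\<exists>r\<in>{1..num_sidings P}.
        (\<forall>i\<in>{1..num_sidings P} - {r}. p ! i = q ! i) \<and>
        p ! 0 @ p ! r = q ! 0 @ q ! r)"

text \<open>Paths in the inglenook graph, given by their (pairwise distinct) vertices.\<close>

definition inglenook_path :: "'a puzzle \<Rightarrow> 'a position list \<Rightarrow> bool" where
  "inglenook_path P ps \<longleftrightarrow>
     ps \<noteq> [] \<and> distinct ps \<and> set ps \<subseteq> positions P \<and> successively (move P) ps"

definition num_moves :: "'a position list \<Rightarrow> nat" where
  "num_moves ps = length ps - 1"

definition solution :: "'a puzzle \<Rightarrow> 'a position \<Rightarrow> 'a position list \<Rightarrow> bool" where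
  "solution P p ps \<longleftrightarrow> inglenook_path P ps \<and> hd ps = p \<and> last ps \<in> finishes P"

definition always_solvable :: "'a puzzle \<Rightarrow> bool" where
  "always_solvable P \<longleftrightarrow> (\<forall>p\<in>starts P. \<exists>ps. solution P p ps)"

definition natural :: "'a puzzle \<Rightarrow> bool" where
  "natural P \<longleftrightarrow>
     (\<forall>f. bij_betw f (wagons P) (wagons P) \<longrightarrow> (\<forall>p\<in>starts P. map (map f) p \<in> starts P)) \<and>
     (\<exists>z\<in>{1..num_sidings P}. \<exists>\<omega>\<in>wagons P.
        \<forall>q\<in>finishes P. q ! z \<noteq> [] \<and> last (q ! z) = \<omega>)"

end

theory Submission
  imports Defs "HOL-Library.Multiset"
begin

text \<open>
  Upper bound.  If some track could not be cleared with one slot to spare elsewhere (or the headshunt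
  could not be emptied at all), then some wagon is stuck: the last wagon of \<open>W\<^sub>0 W\<^sub>i\<close>, respectively the
  first wagon of \<open>W\<^sub>0\<close>, never changes.  By naturality the stuck wagon may be chosen freely, which
  contradicts the condition on \<open>\<omega>\<close>.  With this much room any two positions are connected: bring the
  wagon wanted at the buffer stop of a longest siding there in \<open>4w + 6\<close> moves, then shorten that siding
  by one and continue with the remaining \<open>w - 1\<close> wagons.

  Lower bound.  Take two long sidings and a headshunt of length 2.  A move transposes at most two
  adjacent wagons of the line \<open>rev W\<^sub>1 W\<^sub>0 W\<^sub>2\<close>, and only if it leaves \<open>W\<^sub>2\<close> alone, so twice the number of
  inversions of this line minus \<open>|W\<^sub>2|\<close> drops by at most 2 per move.
\<close>

section \<open>Connectedness of roomy yards\<close>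

locale yard =
  fixes I :: "nat set" and h :: nat
  assumes finite_sidings: "finite I" and headshunt_pos: "h > 0"
begin

text \<open>The number \<open>n\<close> is only an upper bound for the number of moves.  The siding lengths \<open>m\<close> vary in the
  induction and may drop to 0.\<close>

inductive reach :: "(nat \<Rightarrow> nat) \<Rightarrow> nat \<Rightarrow> 'a list \<Rightarrow> (nat \<Rightarrow> 'a list) \<Rightarrow> 'a list \<Rightarrow> (nat \<Rightarrow> 'a list) \<Rightarrow> bool"
  for m where
  refl: "reach m n H T H T"
| step: "reach m n H T H' T' \<Longrightarrow> H' @ T' r = H'' @ t \<Longrightarrow> length H'' \<le> h \<Longrightarrow> length t \<le> m r
    \<Longrightarrow> reach m (Suc n) H T H'' (T'(r := t))"

definition fits :: "(nat \<Rightarrow> nat) \<Rightarrow> 'a list \<Rightarrow> (nat \<Rightarrow> 'a list) \<Rightarrow> bool" where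
  "fits m H T \<longleftrightarrow> length H \<le> h \<and> (\<forall>i. length (T i) \<le> m i)"

text \<open>Together with \<open>fits\<close>, capacity 0 off \<open>I\<close> keeps the tracks
  outside \<open>I\<close> empty. A step of \<open>reach\<close> at such an \<open>r\<close> changes
  nothing, which is why \<open>reach\<close> allows every \<open>r\<close>.\<close>

definition only_sidings :: "(nat \<Rightarrow> nat) \<Rightarrow> bool" where
  "only_sidings m \<longleftrightarrow> (\<forall>i. i \<notin> I \<longrightarrow> m i = 0)"

text \<open>A multiset is conserved by every step without any bookkeeping of distinctness, and its
  \<open>size\<close> is the number of wagons.\<close>

definition content :: "'a list \<Rightarrow> (nat \<Rightarrow> 'a list) \<Rightarrow> 'a multiset" where
  "content H T = mset H + (\<Sum>i\<in>I. mset (T i))"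

section \<open>Composing and reversing sequences of steps\<close>

lemma fits_siding: "fits m H T \<Longrightarrow> length (T i) \<le> m i"
  by (simp add: fits_def)

lemma reach_trans:
  assumes "reach m b H' T' H'' T''" "reach m a H T H' T'"
  shows "reach m (a + b) H T H'' T''"
  using assms
proof (induction rule: reach.induct)
  case (refl n H' T')
  \<comment> \<open>\<open>refl\<close> carries an arbitrary bound \<open>n\<close>, so here the
    first leg has to be weakened from \<open>a\<close> to \<open>a + n\<close>; this is done by
    induction on that leg.\<close>
  then show ?case
  proof (induction rule: reach.induct)
    case (refl n' H T)
    show ?case by (rule reach.refl)
  next
    case (step n' H T H' T' r H'' t)
    from reach.step[OF step.IH step.hyps(2-4)] show ?case by (simp only: add_Suc)
  qed
next
  case (step n H T H' T' r H'' t)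
  from reach.step[OF step.IH[OF step.prems] step.hyps(2-4)] show ?case by (simp only: add_Suc_right)
qed

lemma reach_mono:
  assumes "reach m a H T H' T'" "a \<le> b"
  shows "reach m b H T H' T'"
  using reach_trans[OF reach.refl[of m "b - a"] assms(1)] assms(2) by simp

lemma reach_pull:
  assumes "T r = Y @ R" "length H + length Y \<le> h" "length R \<le> m r"
  shows "reach m 1 H T (H @ Y) (T(r := R))"
  using reach.step[OF reach.refl[of m 0 H T], of r "H @ Y" R] assms by simp

lemma reach_push:
  assumes "length H \<le> h" "length Y + length (T r) \<le> m r"
  shows "reach m 1 (H @ Y) T H (T(r := Y @ T r))"
  using reach.step[OF reach.refl[of m 0 "H @ Y" T], of r H "Y @ T r"] assms by simp

lemma fits_reach:
  assumes "reach m n H T H' T'" "fits m H T"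
  shows "fits m H' T'"
  using assms
proof (induction rule: reach.induct)
  case (refl n H T)
  then show ?case .
next
  case (step n H T H' T' r H'' t)
  show ?case using step.IH[OF step.prems] step.hyps(3,4) by (simp add: fits_def)
qed

lemma content_upd:
  assumes "i \<in> I"
  shows "content H (T(i := t)) = mset H + mset t + (\<Sum>j\<in>I - {i}. mset (T j))"
proof -
  have "(\<Sum>j\<in>I - {i}. mset ((T(i := t)) j)) = (\<Sum>j\<in>I - {i}. mset (T j))"
    by (rule sum.cong) auto
  then show ?thesis
    using sum.remove[OF finite_sidings assms, of "\<lambda>j. mset ((T(i := t)) j)"]
    by (simp add: content_def)
qed

lemma content_reach:
  assumes "reach m n H T H' T'" "fits m H T" "only_sidings m"
  shows "content H' T' = content H T"
  using assms
proof (induction rule: reach.induct)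
  case (refl n H T)
  show ?case by simp
next
  case (step n H T H' T' r H'' t)
  have "fits m H' T'" using step fits_reach by blast
  show ?case
  proof (cases "r \<in> I")
    case True
    have "mset H' + mset (T' r) = mset H'' + mset t" by (metis step.hyps(2) mset_append)
    then have "content H'' (T'(r := t)) = content H' (T'(r := T' r))"
      unfolding content_upd[OF True] by simp
    then show ?thesis using step.IH step.prems by (simp del: fun_upd_apply)
  next
    case False
    then have "m r = 0" using step.prems by (simp add: only_sidings_def)
    then have "t = []" "T' r = []"
      using step.hyps(4) fits_siding[OF \<open>fits m H' T'\<close>, of r] by auto
    then have "H'' = H'" "T'(r := t) = T'" using step.hyps(2) by auto
    then show ?thesis using step by simp
  qed
qed

text \<open>A step is undone by a step at the same siding; \<open>fits\<close> supplies the length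
  bounds for the tracks that are restored.\<close>

lemma reach_sym:
  assumes "reach m n H T H' T'" "fits m H T"
  shows "reach m n H' T' H T"
  using assms
proof (induction rule: reach.induct)
  case (refl n H T)
  show ?case by (rule reach.refl)
next
  case (step n H T H' T' r H'' t)
  have "fits m H' T'" using step fits_reach by blast
  then have "reach m 1 H'' (T'(r := t)) H' ((T'(r := t))(r := T' r))"
    using reach.step[OF reach.refl[of m 0 H'' "T'(r := t)"], of r H' "T' r"] step.hyps(2)
    by (simp add: fits_def)
  then have "reach m 1 H'' (T'(r := t)) H' T'" by simp
  from reach_trans[OF step.IH[OF step.prems] this] show ?case by (rule reach_mono) simp
qed

text \<open>A wagon left at the buffer stop of siding \<open>i\<close> just shortens the siding.\<close>

lemma reach_extend_bottom:
  assumes "reach (m(i := m i - 1)) n H T H' T'" "m i > 0"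
  shows "reach m n H (T(i := T i @ [x])) H' (T'(i := T' i @ [x]))"
  using assms
proof (induction rule: reach.induct)
  case (refl n H T)
  show ?case by (rule reach.refl)
next
  case (step n H T H' T' r H'' t)
  show ?case
  proof (cases "r = i")
    case True
    have "reach m (Suc n) H (T(i := T i @ [x])) H'' ((T'(i := T' i @ [x]))(i := t @ [x]))"
      by (rule reach.step[OF step.IH[OF step.prems]]) (use step.hyps step.prems True in auto)
    moreover have "(T'(i := T' i @ [x]))(i := t @ [x]) = (T'(r := t))(i := (T'(r := t)) i @ [x])"
      using True by auto
    ultimately show ?thesis by (simp only:)
  next
    case False
    have "reach m (Suc n) H (T(i := T i @ [x])) H'' ((T'(i := T' i @ [x]))(r := t))"
      by (rule reach.step[OF step.IH[OF step.prems]]) (use step.hyps False in auto)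
    moreover have "(T'(i := T' i @ [x]))(r := t) = (T'(r := t))(i := (T'(r := t)) i @ [x])"
      using False by auto
    ultimately show ?thesis by (simp only:)
  qed
qed

section \<open>Transferring wagons one at a time between sidings\<close>

lemma reach_transfer:
  assumes "T j = u # R" "length (T k) < m k" "length H < h" "length (T j) \<le> m j" "j \<noteq> k"
  shows "reach m 2 H T H (T(j := R, k := u # T k))"
proof -
  have 1: "reach m 1 H T (H @ [u]) (T(j := R))"
    by (rule reach_pull) (use assms in auto)
  have "reach m 1 (H @ [u]) (T(j := R)) H ((T(j := R))(k := [u] @ (T(j := R)) k))"
    by (rule reach_push) (use assms in auto)
  from reach_trans[OF this 1] show ?thesis using assms(5) by (simp add: numeral_2_eq_2)
qed

text \<open>Wagons pass through the headshunt singly, so one free slot there is enough, and their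
  order is reversed.\<close>

lemma reach_transfer_all:
  assumes "T j = D @ R" "length D + length (T k) \<le> m k" "length H < h" "length (T j) \<le> m j" "j \<noteq> k"
  shows "reach m (2 * length D) H T H (T(j := R, k := rev D @ T k))"
  using assms
proof (induction D arbitrary: T)
  case Nil
  then have T: "T(j := R, k := rev [] @ T k) = T" by auto
  show ?case unfolding T by (rule reach.refl)
next
  case (Cons u D)
  let ?T = "T(j := D @ R, k := u # T k)"
  have 1: "reach m 2 H T H ?T" by (rule reach_transfer) (use Cons.prems in auto)
  have "reach m (2 * length D) H ?T H (?T(j := R, k := rev D @ ?T k))"
    by (rule Cons.IH) (use Cons.prems in auto)
  from reach_trans[OF this 1]
  have "reach m (2 * length (u # D)) H T H (?T(j := R, k := rev D @ ?T k))" by (rule reach_mono) simp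
  moreover have "?T(j := R, k := rev D @ ?T k) = T(j := R, k := rev (u # D) @ T k)"
    using Cons.prems(5) by auto
  ultimately show ?case by (simp only:)
qed

text \<open>Greedy: the top wagon of siding \<open>j\<close> goes to any siding of \<open>K\<close>
  with a free slot, until \<open>D\<close> is used up or \<open>K\<close> is full. Charging only for
  the wagons that moved leaves \<open>2 * length D'\<close> moves to pay for the manoeuvres that
  follow in the second case.\<close>

lemma reach_unload:
  assumes "fits m H T" "length H < h" "j \<notin> K" "T j = D @ R"
  shows "\<exists>D' T'. reach m (2 * (length D - length D')) H T H T' \<and> T' j = D' @ R \<and>
    length D' \<le> length D \<and> (\<forall>i. i \<notin> K \<longrightarrow> i \<noteq> j \<longrightarrow> T' i = T i) \<and>
    (D' = [] \<or> (\<forall>k\<in>K. length (T' k) = m k))"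
  using assms
proof (induction D arbitrary: T)
  case Nil
  then show ?case by (intro exI[of _ "[]"] exI[of _ T]) (auto intro: reach.refl)
next
  case (Cons u D)
  show ?case
  proof (cases "\<forall>k\<in>K. length (T k) = m k")
    case True
    then show ?thesis using Cons.prems
      by (intro exI[of _ "u # D"] exI[of _ T]) (auto intro: reach.refl)
  next
    case False
    then obtain k where k: "k \<in> K" "length (T k) < m k"
      using Cons.prems(1) by (auto simp: fits_def nat_less_le)
    have jk: "j \<noteq> k" using k Cons.prems by auto
    let ?T = "T(j := D @ R, k := u # T k)"
    have 1: "reach m 2 H T H ?T"
      by (rule reach_transfer[OF Cons.prems(4)[simplified] k(2) Cons.prems(2) fits_siding[OF Cons.prems(1)] jk])
    have "fits m H ?T" using fits_reach[OF 1] Cons.prems(1) by blast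
    moreover have "?T j = D @ R" using jk by simp
    ultimately obtain D' T' where
      2: "reach m (2 * (length D - length D')) H ?T H T'" and
      3: "T' j = D' @ R" "length D' \<le> length D" "\<forall>i. i \<notin> K \<longrightarrow> i \<noteq> j \<longrightarrow> T' i = ?T i"
        "D' = [] \<or> (\<forall>k\<in>K. length (T' k) = m k)"
      using Cons.IH[OF _ Cons.prems(2,3)] by blast
    have "reach m (2 * (length (u # D) - length D')) H T H T'"
      by (rule reach_mono[OF reach_trans[OF 2 1]]) (use 3(2) in auto)
    moreover have "\<forall>i. i \<notin> K \<longrightarrow> i \<noteq> j \<longrightarrow> T' i = T i" using 3(3) k(1) by auto
    ultimately show ?thesis using 3
      by (intro exI[of _ D'] exI[of _ T']) auto
  qed
qed

section \<open>Counting free slots, and bringing one wagon to a buffer stop\<close>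

lemma size_content: "size (content H T) = length H + (\<Sum>i\<in>I. length (T i))"
  by (simp add: content_def size_multiset_sum)

lemma length_siding_le: 
  assumes "j \<in> I"
  shows "length H + length (T j) \<le> size (content H T)"
  using sum.remove[OF finite_sidings assms, of "\<lambda>i. length (T i)"] by (simp add: size_content)

lemma siding_in:
  assumes "only_sidings m" "fits m H T" "T j \<noteq> []"
  shows "j \<in> I"
  using assms by (metis only_sidings_def fits_def le_zero_eq length_0_conv)

text \<open>Turns a bound on the number of wagons into a bound on what remains in the headshunt and
  on siding \<open>i\<close> once the other sidings are full.\<close>

lemma size_content_full:
  assumes "i \<in> I" "\<And>k. k \<in> I \<Longrightarrow> k \<noteq> i \<Longrightarrow> length (T k) = m k"
  shows "size (content H T) + m i = length H + length (T i) + sum m I"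
proof -
  have "(\<Sum>k\<in>I - {i}. length (T k)) = sum m (I - {i})"
    by (rule sum.cong) (use assms in auto)
  then show ?thesis
    using sum.remove[OF finite_sidings assms(1), of "\<lambda>i. length (T i)"]
      sum.remove[OF finite_sidings assms(1), of m] by (simp add: size_content)
qed

lemma size_content_le:
  assumes "fits m H T"
  shows "size (content H T) \<le> length H + sum m I"
  using assms sum_mono[of I "\<lambda>i. length (T i)" m] by (auto simp: size_content fits_def)

lemma ex_other:
  assumes "card {i\<in>I. m i > (0::nat)} > card X" "finite X"
  shows "\<exists>k\<in>I. k \<notin> X \<and> m k > 0"
proof (rule ccontr)
  assume "\<not> ?thesis"
  then have "{i\<in>I. m i > 0} \<subseteq> X" by auto
  then show False using assms card_mono leD by blast
qed

text \<open>If the wagons above \<open>x\<close> overflow all the other sidings, then \<open>x\<close> and what is still above it fit into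
  the headshunt with a slot to spare.  That slot serves to exchange \<open>x\<close> with the top \<open>u\<close> of another
  siding.\<close>

lemma dig:
  assumes fits: "fits m [] T" and m: "only_sidings m"
    and room: "size (content [] T) + 1 + m j \<le> h + sum m I"
    and two: "card {i\<in>I. m i > 0} \<ge> 2"
    and T: "T j = D @ x # R"
  shows "\<exists>T' k R'. reach m (2 * length D + (if h = 1 then 0 else 3)) [] T [] T' \<and> T' k = x # R'"
proof -
  have j: "j \<in> I" by (rule siding_in[OF m fits]) (simp add: T)
  obtain D' T' where 1: "reach m (2 * (length D - length D')) [] T [] T'"
    and T': "T' j = D' @ x # R" "length D' \<le> length D"
    and full: "D' = [] \<or> (\<forall>k\<in>I - {j}. length (T' k) = m k)"
    using reach_unload[OF fits _ _ T, of "I - {j}"] headshunt_pos by auto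
  show ?thesis
  proof (cases "D' = []")
    case True
    have "reach m (2 * length D + (if h = 1 then 0 else 3)) [] T [] T'"
      by (rule reach_mono[OF 1]) simp
    moreover have "T' j = x # R" using T' True by simp
    ultimately show ?thesis by blast
  next
    case False
    have fits': "fits m [] T'" using fits_reach[OF 1 fits] .
    have "size (content [] T') + m j = length (T' j) + sum m I"
      using size_content_full[OF j, of T' m "[]"] full False by simp
    \<comment> \<open>All sidings but \<open>j\<close> are full, so \<open>room\<close> bounds the
      remainder of siding \<open>j\<close> by \<open>h - 1\<close>.\<close>
    then have len: "length (T' j) + 1 \<le> h"
      using room content_reach[OF 1 fits m] by simp
    obtain k where k: "k \<in> I" "k \<noteq> j" "m k > 0"
      using ex_other[of "{j}" m] two by auto
    have "length (T' k) = m k" using full False k by auto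
    then obtain u U where U: "T' k = u # U" using k(3) by (cases "T' k") auto
    have lenU: "length U < m k" using fits_siding[OF fits', of k] U by simp
    have lenj: "length D' + 1 + length R \<le> m j"
      using fits_siding[OF fits', of j] T'(1) by simp
    \<comment> \<open>Five moves: \<open>D'\<close> and \<open>x\<close> enter the headshunt,
      \<open>u\<close> follows, \<open>u\<close> goes onto siding \<open>j\<close>, \<open>x\<close>
      takes the place of \<open>u\<close> on siding \<open>k\<close>, and \<open>D'\<close> returns
      to \<open>j\<close>.\<close>
    have 2: "reach m 1 [] T' ([] @ (D' @ [x])) (T'(j := R))"
      by (rule reach_pull) (use T' len lenj in auto)
    have 3: "reach m 1 (D' @ [x]) (T'(j := R)) ((D' @ [x]) @ [u]) (T'(j := R, k := U))"
      by (rule reach_pull) (use T' len lenU U k in auto)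
    have 4: "reach m 1 ((D' @ [x]) @ [u]) (T'(j := R, k := U)) (D' @ [x])
        ((T'(j := R, k := U))(j := [u] @ (T'(j := R, k := U)) j))"
      by (rule reach_push) (use False T' len lenj U k in \<open>auto simp: Suc_le_eq\<close>)
    have 5: "reach m 1 (D' @ [x]) (T'(k := U, j := u # R)) D' ((T'(k := U, j := u # R))(k := [x] @ U))"
      using reach_push[of D' "[x]" "T'(k := U, j := u # R)" k m] T' len lenU k by auto
    have 6: "reach m 1 ([] @ D') (T'(j := u # R, k := x # U)) [] ((T'(j := u # R, k := x # U))(j := D' @ u # R))"
      using reach_push[of "[]" D' "T'(j := u # R, k := x # U)" j m] lenj k by auto
    have eq: "(T'(j := R, k := U))(j := [u] @ (T'(j := R, k := U)) j) = T'(k := U, j := u # R)"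
      "(T'(k := U, j := u # R))(k := [x] @ U) = T'(j := u # R, k := x # U)"
      using k by (auto simp: fun_eq_iff)
    have 7: "reach m (2 * (length D - length D') + 1 + 1 + 1 + 1 + 1) [] T []
        ((T'(j := u # R, k := x # U))(j := D' @ u # R))" (is "reach _ _ _ _ _ ?T")
      using reach_trans[OF 6[unfolded append_Nil] reach_trans[OF 5[unfolded eq] reach_trans[OF 4[unfolded eq]
        reach_trans[OF 3 reach_trans[OF 2[unfolded append_Nil] 1]]]]] by simp
    \<comment> \<open>Siding \<open>j\<close> still held \<open>x\<close> and at least one wagon
      above it, so \<open>h\<close> is at least 3 and the surplus 3 is available. The five moves
      minus the \<open>2 * length D'\<close> saved, which is at least 2, stay within it.\<close>
    have "h \<noteq> 1" using len T' False by auto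
    moreover have "length D' > 0" using False by simp
    ultimately have "2 * (length D - length D') + 1 + 1 + 1 + 1 + 1 \<le> 2 * length D + (if h = 1 then 0 else 3)"
      using T'(2) by presburger
    from reach_mono[OF 7 this]
    have "reach m (2 * length D + (if h = 1 then 0 else 3)) [] T [] ?T" .
    moreover have "?T k = x # U" using k by simp
    ultimately show ?thesis by blast
  qed
qed

text \<open>Here \<open>x\<close> waits at the engine end of the headshunt while siding \<open>i\<close> is emptied.  If the other sidings
  fill up first, \<open>x\<close> takes the place of the top \<open>v\<close> of one of them, and the rest of siding \<open>i\<close> fits
  into the headshunt.\<close>

lemma settle_hand:
  assumes fits: "fits m [x] T" and m: "only_sidings m" and h: "h \<ge> 2"
    and len: "size (content [x] T) \<le> sum m I"
    and room: "size (content [x] T) + 1 + m i \<le> h + sum m I"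
    and two: "card {i\<in>I. m i > 0} \<ge> 2"
    and i: "i \<in> I" "m i > 0"
  shows "\<exists>T' V. reach m (2 * length (T i) + 6) [x] T [] T' \<and> T' i = V @ [x]"
proof -
  obtain D T' where 1: "reach m (2 * (length (T i) - length D)) [x] T [x] T'"
    and T': "T' i = D" "length D \<le> length (T i)"
    and full: "D = [] \<or> (\<forall>k\<in>I - {i}. length (T' k) = m k)"
    using reach_unload[OF fits _ _ append_Nil2[symmetric, of "T i"], of "I - {i}"] h by auto
  show ?thesis
  proof (cases "D = []")
    case True
    have "reach m 1 ([] @ [x]) T' [] (T'(i := [x] @ T' i))"
      by (rule reach_push) (use i T' True in auto)
    from reach_trans[OF this[unfolded append_Nil] 1]
    have "reach m (2 * length (T i) + 6) [x] T [] (T'(i := [x] @ T' i))"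
      by (rule reach_mono) simp
    then show ?thesis using T' True by (intro exI[of _ "T'(i := [x] @ T' i)"] exI[of _ "[]"]) simp
  next
    case False
    have fits': "fits m [x] T'" using fits_reach[OF 1 fits] .
    have "size (content [x] T') + m i = 1 + length (T' i) + sum m I"
      using size_content_full[OF i(1), of T' m "[x]"] full False by simp
    \<comment> \<open>\<open>room\<close> lets \<open>x\<close>, \<open>D\<close> and one more wagon
      fit into the headshunt; \<open>len\<close> leaves a free slot on siding \<open>i\<close> for
      \<open>v\<close>.\<close>
    then have lenh: "length D + 2 \<le> h" and leni: "length D + 1 \<le> m i"
      using room len content_reach[OF 1 fits m] T' by auto
    obtain k where k: "k \<in> I" "k \<noteq> i" "m k > 0"
      using ex_other[of "{i}" m] two by auto
    have "length (T' k) = m k" using full False k by auto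
    then obtain v U where U: "T' k = v # U" using k(3) by (cases "T' k") auto
    have lenU: "length U < m k" using fits_siding[OF fits', of k] U by simp
    \<comment> \<open>Eight moves: \<open>v\<close> is pulled behind \<open>x\<close> and pushed
      onto siding \<open>i\<close>, \<open>x\<close> replaces it on siding \<open>k\<close>,
      \<open>v\<close> and \<open>D\<close> are pulled together, \<open>x\<close> is pulled behind
      them and pushed onto the empty siding \<open>i\<close>, then \<open>D\<close> follows onto
      \<open>i\<close> and \<open>v\<close> returns to \<open>k\<close>. Two of the eight are paid
      for by the nonempty \<open>D\<close>.\<close>
    have 2: "reach m 1 [x] T' ([x] @ [v]) (T'(k := U))"
      by (rule reach_pull) (use lenh lenU U in auto)
    have 3: "reach m 1 ([x] @ [v]) (T'(k := U)) [x] ((T'(k := U))(i := [v] @ (T'(k := U)) i))"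
      by (rule reach_push) (use lenh leni k T' in auto)
    have 4: "reach m 1 ([] @ [x]) (T'(k := U, i := v # D)) [] ((T'(k := U, i := v # D))(k := [x] @ (T'(k := U, i := v # D)) k))"
      by (rule reach_push) (use lenU k in auto)
    have 5: "reach m 1 [] (T'(i := v # D, k := x # U)) ([] @ (v # D)) ((T'(i := v # D, k := x # U))(i := []))"
      by (rule reach_pull) (use lenh k in auto)
    have 6: "reach m 1 (v # D) (T'(i := [], k := x # U)) ((v # D) @ [x]) ((T'(i := [], k := x # U))(k := U))"
      by (rule reach_pull) (use lenh k lenU in auto)
    have 7: "reach m 1 ((v # D) @ [x]) (T'(i := [], k := U)) (v # D) ((T'(i := [], k := U))(i := [x] @ (T'(i := [], k := U)) i))"
      by (rule reach_push) (use lenh k i in auto)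
    have 8: "reach m 1 ([v] @ D) (T'(k := U, i := [x])) [v] ((T'(k := U, i := [x]))(i := D @ (T'(k := U, i := [x])) i))"
      by (rule reach_push) (use lenh leni in auto)
    have 9: "reach m 1 ([] @ [v]) (T'(k := U, i := D @ [x])) [] ((T'(k := U, i := D @ [x]))(k := [v] @ (T'(k := U, i := D @ [x])) k))"
      (is "reach _ _ _ _ _ ?T")
      by (rule reach_push) (use lenU k in auto)
    have eq: "(T'(k := U))(i := [v] @ (T'(k := U)) i) = T'(k := U, i := v # D)"
      "(T'(k := U, i := v # D))(k := [x] @ (T'(k := U, i := v # D)) k) = T'(i := v # D, k := x # U)"
      "(T'(i := v # D, k := x # U))(i := []) = T'(i := [], k := x # U)"
      "(T'(i := [], k := x # U))(k := U) = T'(i := [], k := U)"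
      "(T'(i := [], k := U))(i := [x] @ (T'(i := [], k := U)) i) = T'(k := U, i := [x])"
      "(T'(k := U, i := [x]))(i := D @ (T'(k := U, i := [x])) i) = T'(k := U, i := D @ [x])"
      using k T' by (auto simp: fun_eq_iff)
    have v: "[v] @ D = v # D" by simp
    note reach_trans[OF 9[unfolded append_Nil] reach_trans[OF 8[unfolded eq v] reach_trans[OF 7[unfolded eq]
      reach_trans[OF 6[unfolded eq] reach_trans[OF 5[unfolded eq append_Nil] reach_trans[OF 4[unfolded eq append_Nil]
      reach_trans[OF 3[unfolded eq] reach_trans[OF 2 1]]]]]]]]
    moreover have "length D > 0" using False by simp
    then have "2 * (length (T i) - length D) + 1 + 1 + 1 + 1 + 1 + 1 + 1 + 1 \<le> 2 * length (T i) + 6"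
      using T'(2) by presburger
    ultimately have "reach m (2 * length (T i) + 6) [x] T [] ?T" by (rule reach_mono)
    moreover have "?T i = D @ [x]" using k by simp
    ultimately show ?thesis by blast
  qed
qed

text \<open>With \<open>h = 1\<close> the wagon \<open>x\<close> has to wait on top of a siding \<open>j\<close>.  When all sidings but \<open>i\<close> and \<open>j\<close> are
  full, \<open>x\<close> moves over to one of them and uncovers the free slots of \<open>j\<close>.\<close>

lemma settle_stacked:
  assumes fits: "fits m [] T" and m: "only_sidings m" and h: "h = 1"
    and room: "size (content [] T) + m i \<le> sum m I"
    and three: "card {i\<in>I. m i > 0} \<ge> 3"
    and i: "i \<in> I" "m i > 0" "m j \<le> m i"
    and T: "T j = x # R" "j \<noteq> i"
  shows "\<exists>T'. reach m (2 * length (T i) + 8) [] T [] T' \<and> T' i = [x]"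
proof -
  have j: "j \<in> I" by (rule siding_in[OF m fits]) (simp add: T)
  obtain D T' where 1: "reach m (2 * (length (T i) - length D)) [] T [] T'"
    and T': "T' i = D" "length D \<le> length (T i)" "T' j = x # R"
    and full: "D = [] \<or> (\<forall>k\<in>I - {i, j}. length (T' k) = m k)"
    using reach_unload[OF fits _ _ append_Nil2[symmetric, of "T i"], of "I - {i, j}"] headshunt_pos T
    by fastforce
  have fits': "fits m [] T'" using fits_reach[OF 1 fits] .
  show ?thesis
  proof (cases "D = []")
    case True
    have "reach m 2 [] T' [] (T'(j := R, i := x # T' i))"
      by (rule reach_transfer) (use i T' True T h fits_siding[OF fits', of j] in auto)
    from reach_trans[OF this 1]
    have "reach m (2 * length (T i) + 8) [] T [] (T'(j := R, i := x # T' i))"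
      by (rule reach_mono) simp
    then show ?thesis using T' True by (intro exI[of _ "T'(j := R, i := x # T' i)"]) simp
  next
    case False
    have "(\<Sum>k\<in>I - {i} - {j}. length (T' k)) = sum m (I - {i} - {j})"
      by (rule sum.cong) (use full False in auto)
    moreover have "sum f I = f i + (f j + sum f (I - {i} - {j}))" for f :: "nat \<Rightarrow> nat"
      using sum.remove[OF finite_sidings i(1), of f] sum.remove[of "I - {i}" j f] finite_sidings j T
      by simp
    note this[of m] this[of "\<lambda>k. length (T' k)"]
    ultimately have "size (content [] T') + m i + m j = length D + (length R + 1) + sum m I"
      using T' by (simp add: size_content)
    \<comment> \<open>With all sidings but \<open>i\<close> and \<open>j\<close> full,
      \<open>room\<close> shows that siding \<open>j\<close> can take \<open>D\<close> and one more
      wagon once \<open>x\<close> has left it.\<close>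
    then have lenj: "length D + (length R + 1) \<le> m j"
      using room content_reach[OF 1 fits m] by auto
    obtain k where k: "k \<in> I" "k \<noteq> i" "k \<noteq> j" "m k > 0"
      using ex_other[of "{i, j}" m] three T by auto
    have "length (T' k) = m k" using full False k by auto
    then obtain v U where U: "T' k = v # U" using k(4) by (cases "T' k") auto
    have lenU: "length U < m k" using fits_siding[OF fits', of k] U by simp
    \<comment> \<open>\<open>v\<close> moves onto siding \<open>i\<close>, which has a free slot
      because \<open>m j \<le> m i\<close>; \<open>x\<close> replaces \<open>v\<close> on siding
      \<open>k\<close>; \<open>v\<close> and \<open>D\<close> move over to siding \<open>j\<close>;
      finally \<open>x\<close> enters the empty siding \<open>i\<close>. Since \<open>D\<close> is
      moved at most once more, its \<open>2 * length D\<close> moves are exactly those saved by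
      unloading.\<close>
    have 2: "reach m 2 [] T' [] (T'(k := U, i := v # T' i))"
      by (rule reach_transfer) (use U lenj lenU i T' k h in auto)
    have 3: "reach m 2 [] (T'(k := U, i := v # D)) []
        ((T'(k := U, i := v # D))(j := R, k := x # (T'(k := U, i := v # D)) k))"
      by (rule reach_transfer) (use U lenj lenU i T' k T h in auto)
    have 4: "reach m (2 * length (v # D)) [] (T'(i := v # D, j := R, k := x # U)) []
        ((T'(i := v # D, j := R, k := x # U))(i := [], j := rev (v # D) @ (T'(i := v # D, j := R, k := x # U)) j))"
      by (rule reach_transfer_all) (use U lenj lenU i T' k T h in auto)
    let ?S = "T'(i := [], j := rev (v # D) @ R, k := x # U)"
    have 5: "reach m 2 [] ?S [] (?S(k := U, i := x # ?S i))"
      by (rule reach_transfer) (use lenU i T k h in auto)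
    have eq: "(T'(k := U, i := v # D))(j := R, k := x # (T'(k := U, i := v # D)) k)
        = T'(i := v # D, j := R, k := x # U)"
      "(T'(i := v # D, j := R, k := x # U))(i := [], j := rev (v # D) @ (T'(i := v # D, j := R, k := x # U)) j) = ?S"
      using k T U by (auto simp: fun_eq_iff)
    note reach_trans[OF 5 reach_trans[OF 4[unfolded eq] reach_trans[OF 3[unfolded eq]
      reach_trans[OF 2[unfolded T'(1)] 1]]]]
    moreover have "2 * (length (T i) - length D) + 2 + 2 + 2 * length (v # D) + 2 \<le> 2 * length (T i) + 8"
      using T'(2) by simp
    ultimately have "reach m (2 * length (T i) + 8) [] T [] (?S(k := U, i := x # ?S i))"
      by (rule reach_mono)
    moreover have "(?S(k := U, i := x # ?S i)) i = [x]" using T k by simp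
    ultimately show ?thesis by blast
  qed
qed

text \<open>The first condition says that siding \<open>i\<close> can be cleared with one slot to
  spare elsewhere. The others ask for two sidings, or three if \<open>h = 1\<close>. Only sidings of
  positive length count, since the induction may shrink a siding to length 0.\<close>

definition roomy :: "(nat \<Rightarrow> nat) \<Rightarrow> nat \<Rightarrow> bool" where
  "roomy m w \<longleftrightarrow> (\<forall>i\<in>I. w + 1 + m i \<le> h + sum m I) \<and>
     2 \<le> card {i\<in>I. m i > 0} \<and> 4 \<le> h + card {i\<in>I. m i > 0}"

text \<open>First \<open>x\<close> is exposed by \<open>dig\<close>, then it is settled by
  \<open>settle_hand\<close> if \<open>h \<ge> 2\<close> and by \<open>settle_stacked\<close> if
  \<open>h = 1\<close>. The wagons above \<open>x\<close> and those later cleared from siding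
  \<open>i\<close> do not include \<open>x\<close>, so each group has at most \<open>w - 1\<close>
  members for \<open>w\<close> wagons in all; this gives \<open>4 * w + 6\<close>.\<close>

lemma bring_to_bottom:
  assumes fits: "fits m [] T" and m: "only_sidings m" and roomy: "roomy m (size (content [] T))"
    and i: "i \<in> I" "m i > 0" "\<And>j. j \<in> I \<Longrightarrow> m j \<le> m i"
    and x: "x \<in># content [] T"
  shows "\<exists>T' V. reach m (4 * size (content [] T) + 6) [] T [] T' \<and> T' i = V @ [x]"
proof -
  let ?w = "size (content [] T)"
  have two: "2 \<le> card {i\<in>I. m i > 0}" and three: "h = 1 \<Longrightarrow> 3 \<le> card {i\<in>I. m i > 0}"
    and room: "\<And>i. i \<in> I \<Longrightarrow> ?w + 1 + m i \<le> h + sum m I"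
    using roomy unfolding roomy_def by auto
  obtain j where j: "j \<in> I" "x \<in> set (T j)"
    using x finite_sidings by (auto simp: content_def set_mset_sum)
  then obtain D R where T: "T j = D @ x # R" by (auto simp: in_set_conv_decomp)
  have lenD: "length D + 1 \<le> ?w"
    using length_siding_le[OF j(1), of "[]" T] T by simp
  obtain T1 k R1 where 1: "reach m (2 * length D + (if h = 1 then 0 else 3)) [] T [] T1"
    and T1: "T1 k = x # R1"
    using dig[OF fits m room[OF j(1)] two T] by auto
  have fits1: "fits m [] T1" and c1: "content [] T1 = content [] T"
    using fits_reach[OF 1 fits] content_reach[OF 1 fits m] by auto
  have k: "k \<in> I" by (rule siding_in[OF m fits1]) (simp add: T1)
  show ?thesis
  proof (cases "h = 1")
    case False
    then have h: "h \<ge> 2" using headshunt_pos by simp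
    have 2: "reach m 1 [] T1 ([] @ [x]) (T1(k := R1))"
      by (rule reach_pull) (use T1 h fits_siding[OF fits1, of k] in auto)
    define T2 where "T2 = T1(k := R1)"
    have 2: "reach m 1 [] T1 [x] T2" using 2 by (simp add: T2_def)
    have fits2: "fits m [x] T2" and c2: "content [x] T2 = content [] T"
      using fits_reach[OF 2 fits1] content_reach[OF 2 fits1 m] c1 by auto
    have leni: "length (T2 i) + 1 \<le> ?w"
      using length_siding_le[OF i(1), of "[x]" T2] c2 by simp
    have "?w \<le> sum m I" using size_content_le[OF fits] by simp
    then obtain T' V where 3: "reach m (2 * length (T2 i) + 6) [x] T2 [] T'" and T': "T' i = V @ [x]"
      using settle_hand[OF fits2 m h _ _ two i(1,2)] room[OF i(1)] c2 by auto
    have "2 * length D + (if h = 1 then 0 else 3) + 1 + (2 * length (T2 i) + 6) \<le> 4 * ?w + 6"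
      using lenD leni by simp
    from reach_mono[OF reach_trans[OF 3 reach_trans[OF 2 1]] this] T' show ?thesis by blast
  next
    case True
    have rm: "?w + m i \<le> sum m I" using room[OF i(1)] True by simp
    show ?thesis
    proof (cases "k = i")
      case False
      have leni: "length (T1 i) + 1 \<le> ?w"
        using sum.remove[OF finite_sidings k, of "\<lambda>i. length (T1 i)"]
          sum.remove[of "I - {k}" i "\<lambda>i. length (T1 i)"] finite_sidings i False T1 c1
        by (simp add: size_content flip: c1)
      obtain T' where 2: "reach m (2 * length (T1 i) + 8) [] T1 [] T'" and T': "T' i = [x]"
        using settle_stacked[OF fits1 m True _ three[OF True] i(1,2) i(3)[OF k] T1 False] rm c1 by auto
      have "2 * length D + (if h = 1 then 0 else 3) + (2 * length (T1 i) + 8) \<le> 4 * ?w + 6"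
        using lenD leni True by simp
      from reach_mono[OF reach_trans[OF 2 1] this] T' show ?thesis by (metis append_Nil)
    next
      case ki: True
      \<comment> \<open>\<open>settle_stacked\<close> wants \<open>x\<close> on top of a siding
        other than \<open>i\<close>. If every other siding were full, \<open>rm\<close> would leave
        no wagon on siding \<open>i\<close>, yet \<open>x\<close> stands there.\<close>
      have "\<exists>l\<in>I. l \<noteq> i \<and> length (T1 l) < m l"
      proof (rule ccontr)
        assume "\<not> ?thesis"
        then have "\<And>l. l \<in> I \<Longrightarrow> l \<noteq> i \<Longrightarrow> length (T1 l) = m l"
          using fits_siding[OF fits1] by (meson le_neq_implies_less)
        from size_content_full[of i T1 m "[]", OF i(1) this] show False
          using rm c1 T1 ki by simp
      qed
      then obtain l where l: "l \<in> I" "l \<noteq> i" "length (T1 l) < m l" by blast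
      define T2 where "T2 = T1(i := R1, l := x # T1 l)"
      have 2: "reach m 2 [] T1 [] T2" unfolding T2_def
        by (rule reach_transfer) (use T1 ki l fits_siding[OF fits1, of i] True in auto)
      have fits2: "fits m [] T2" and c2: "content [] T2 = content [] T"
        using fits_reach[OF 2 fits1] content_reach[OF 2 fits1 m] c1 by auto
      have T2: "T2 l = x # T1 l" "T2 i = R1" using l by (auto simp: T2_def)
      have leni: "length (T2 i) + 1 \<le> ?w"
        using length_siding_le[OF i(1), of "[]" T1] T1 T2 ki c1 by simp
      obtain T' where 3: "reach m (2 * length (T2 i) + 8) [] T2 [] T'" and T': "T' i = [x]"
        using settle_stacked[OF fits2 m True _ three[OF True] i(1,2) i(3)[OF l(1)] T2(1) l(2)] rm c2 by auto
      have "2 * length D + (if h = 1 then 0 else 3) + 2 + (2 * length (T2 i) + 8) \<le> 4 * ?w + 6"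
        using lenD leni True by simp
      from reach_mono[OF reach_trans[OF 3 reach_trans[OF 2 1]] this] T' show ?thesis by (metis append_Nil)
    qed
  qed
qed

text \<open>The wagon count and the total length drop together, so the room condition survives. The
  number of usable sidings changes only if \<open>m i = 1\<close>. As siding \<open>i\<close> is a
  longest one, all usable sidings then have length 1, and their number equals
  \<open>sum m I\<close>, which is at least 3; the room condition for \<open>i\<close> gives the
  bound involving \<open>h\<close>.\<close>

lemma roomy_reduce:
  assumes roomy: "roomy m (Suc w)" and w: "w \<ge> 2" "Suc w \<le> sum m I"
    and i: "i \<in> I" "m i > 0" "\<And>j. j \<in> I \<Longrightarrow> m j \<le> m i"
  shows "roomy (m(i := m i - 1)) w"
proof -
  let ?m = "m(i := m i - 1)" and ?N = "{j\<in>I. m j > 0}"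
  have sum: "sum ?m I + 1 = sum m I"
  proof -
    have "sum ?m (I - {i}) = sum m (I - {i})" by (rule sum.cong) auto
    then show ?thesis
      using sum.remove[OF finite_sidings i(1), of m] sum.remove[OF finite_sidings i(1), of ?m] i(2)
      by simp
  qed
  have "2 \<le> card {j\<in>I. ?m j > 0} \<and> 4 \<le> h + card {j\<in>I. ?m j > 0}"
  proof (cases "m i = 1")
    case False
    then have "{j\<in>I. ?m j > 0} = ?N" using i by auto
    then show ?thesis using roomy by (simp add: roomy_def)
  next
    case True
    have "sum m I = sum m ?N"
      by (rule sum.mono_neutral_right) (use finite_sidings in auto)
    also have "\<dots> = (\<Sum>j\<in>?N. 1)"
      by (rule sum.cong) (use i(3) True le_antisym in fastforce)+
    finally have cN: "card ?N = sum m I" by simp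
    have "{j\<in>I. ?m j > 0} = ?N - {i}" using True by auto
    then have c: "card {j\<in>I. ?m j > 0} + 1 = card ?N"
      using card_Suc_Diff1[of ?N i] finite_sidings i by simp
    have "Suc w + 1 + m i \<le> h + sum m I" using roomy i(1) by (simp add: roomy_def)
    then show ?thesis using c cN w headshunt_pos True by auto
  qed
  moreover have "w + 1 + ?m j \<le> h + sum ?m I" if "j \<in> I" for j
  proof -
    have "Suc w + 1 + m j \<le> h + sum m I" using roomy that by (simp add: roomy_def)
    then show ?thesis using sum by auto
  qed
  ultimately show ?thesis by (simp add: roomy_def)
qed

section \<open>The induction on the number of wagons\<close>

lemma connected_single:
  assumes fits: "fits m [] T" "fits m [] T'" and m: "only_sidings m"
    and content: "content [] T' = content [] T" "size (content [] T) = 1"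
  shows "reach m 2 [] T [] T'"
proof -
  have single: "\<exists>a\<in>I. \<exists>x. S = (\<lambda>_. [])(a := [x])" if S: "fits m [] S" "size (content [] S) = 1" for S
  proof -
    from S(2) obtain a where a: "a \<in> I" "length (S a) = 1" "\<forall>b\<in>I. a \<noteq> b \<longrightarrow> length (S b) = 0"
      using sum_eq_1_iff[OF finite_sidings, of "\<lambda>i. length (S i)"] by (auto simp: size_content)
    then obtain x where x: "S a = [x]" by (auto simp: length_Suc_conv)
    have "S b = ((\<lambda>_. [])(a := [x])) b" for b
      using a x siding_in[OF m S(1), of b] by (cases "b = a"; cases "S b = []") auto
    then show ?thesis using a(1) by blast
  qed
  obtain a x where a: "a \<in> I" "T = (\<lambda>_. [])(a := [x])" using single[OF fits(1)] content by auto
  obtain b y where b: "b \<in> I" "T' = (\<lambda>_. [])(b := [y])" using single[OF fits(2)] content by auto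
  have "y = x" using content(1) a b by (simp add: content_upd del: fun_upd_apply)
  show ?thesis
  proof (cases "a = b")
    case True
    then show ?thesis using a b \<open>y = x\<close> by (simp add: reach.refl del: fun_upd_apply)
  next
    case False
    have "reach m 2 [] T [] (T(a := [], b := x # T b))"
      by (rule reach_transfer)
        (use a b False headshunt_pos fits_siding[OF fits(1), of a] fits_siding[OF fits(2), of b] in auto)
    moreover have "T(a := [], b := x # T b) = T'" using a b False \<open>y = x\<close> by auto
    ultimately show ?thesis by simp
  qed
qed

text \<open>The value \<open>2 * w\<^sup>2 + 10 * w - 10\<close> is 2 at \<open>w = 1\<close> and
  grows by \<open>4 * (w + 1) + 8\<close> from \<open>w\<close> to \<open>w + 1\<close>:
  \<open>bring_to_bottom\<close> plus two moves that adjust the target. The bound is stated through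
  \<open>n + 10\<close> to avoid truncated subtraction.\<close>

lemma connected_empty_headshunt:
  assumes "fits m [] T" "fits m [] T'" "only_sidings m"
    and "content [] T' = content [] T" "size (content [] T) = w" "w > 0"
    and "w \<ge> 2 \<Longrightarrow> roomy m w" and "2 * w\<^sup>2 + 10 * w \<le> n + 10"
  shows "reach m n [] T [] T'"
  using assms
proof (induction w arbitrary: m T T' n)
  case 0
  then show ?case by simp
next
  case (Suc w)
  show ?case
  proof (cases "w = 0")
    case True
    then have "reach m 2 [] T [] T'" using connected_single[OF Suc.prems(1-4)] Suc.prems(5) by simp
    then show ?thesis by (rule reach_mono) (use Suc.prems(8) True in simp)
  next
    case False
    then have w: "w \<ge> 1" by simp
    note fits = Suc.prems(1) and fits' = Suc.prems(2) and m = Suc.prems(3)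
    have roomy: "roomy m (Suc w)" using Suc.prems(7) w by simp
    then have "card {i\<in>I. m i > 0} \<noteq> 0" by (auto simp: roomy_def)
    then obtain i' where i': "i' \<in> I" "m i' > 0" by (auto simp: card_eq_0_iff)
    have "Max (m ` I) \<in> m ` I" using finite_sidings i' by (intro Max_in) auto
    then obtain i where "i \<in> I" "m i = Max (m ` I)" by auto
    then have i: "i \<in> I" "\<And>j. j \<in> I \<Longrightarrow> m j \<le> m i"
      using finite_sidings by auto
    then have mi: "m i > 0" using i' by fastforce
    have sum: "Suc w \<le> sum m I" using size_content_le[OF fits] Suc.prems(5) by simp

    \<comment> \<open>If the target leaves siding \<open>i\<close> empty, one wagon is transferred
      there, so that siding \<open>i\<close> has a last wagon \<open>x\<close> to aim for.
      \<open>reach_sym\<close> undoes these two moves at the end.\<close>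
    obtain S' where S': "reach m 2 [] T' [] S'" "S' i \<noteq> []"
    proof (cases "T' i = []")
      case False
      then show ?thesis using that[OF reach.refl[of m 2 "[]" T']] by simp
    next
      case True
      have "\<exists>j\<in>I. length (T' j) \<noteq> 0"
      proof (rule ccontr)
        assume "\<not> ?thesis"
        then have "size (content [] T') = 0" by (simp add: size_content)
        then show False using Suc.prems(4,5) by simp
      qed
      then obtain j u R where j: "T' j = u # R" by (metis length_0_conv neq_Nil_conv)
      have "reach m 2 [] T' [] (T'(j := R, i := u # T' i))"
        by (rule reach_transfer) (use j True mi headshunt_pos fits_siding[OF fits', of j] in auto)
      then show ?thesis using that by simp
    qed
    define x where "x = last (S' i)"
    define V' where "V' = butlast (S' i)"
    have S'i: "S' i = V' @ [x]" using S'(2) by (simp add: x_def V'_def)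
    have fitsS': "fits m [] S'" and cS': "content [] S' = content [] T"
      using fits_reach[OF S'(1) fits'] content_reach[OF S'(1) fits' m] Suc.prems(4) by auto
    have "x \<in># content [] T"
      unfolding cS'[symmetric]
      using S'i i(1) finite_sidings by (auto simp: content_def set_mset_sum intro!: bexI[of _ i])
    then obtain S V where S: "reach m (4 * Suc w + 6) [] T [] S" "S i = V @ [x]"
      using bring_to_bottom[OF fits m _ i(1) mi i(2)] roomy unfolding Suc.prems(5) by blast
    have fitsS: "fits m [] S" and cS: "content [] S = content [] T"
      using fits_reach[OF S(1) fits] content_reach[OF S(1) fits m] by auto

    let ?m = "m(i := m i - 1)"
    have c: "content [] (U(i := X)) + {#x#} = content [] U" if "U i = X @ [x]" for U X
      using content_upd[OF i(1), of "[]" U X] content_upd[OF i(1), of "[]" U "U i", unfolded fun_upd_triv] that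
      by (simp del: fun_upd_apply)
    have fits_m: "fits ?m [] (U(i := X))" if "fits m [] U" "U i = X @ [x]" for U X
      using that(1) fits_siding[OF that(1), of i] that(2) by (auto simp: fits_def)
    \<comment> \<open>Both \<open>S\<close> and \<open>S'\<close> have \<open>x\<close> at the
      buffer stop of siding \<open>i\<close>. Dropping it leaves \<open>w\<close> wagons and a
      siding shorter by one; \<open>4 * Suc w + 8\<close> moves are spent outside this part.\<close>
    have "reach ?m (n - (4 * Suc w + 8)) [] (S(i := V)) [] (S'(i := V'))"
    proof (rule Suc.IH)
      show "fits ?m [] (S(i := V))" "fits ?m [] (S'(i := V'))"
        using fits_m fitsS fitsS' S(2) S'i by auto
      show "only_sidings ?m" using m i(1) by (auto simp: only_sidings_def)
      show "content [] (S'(i := V')) = content [] (S(i := V))"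
        using c[of S V, OF S(2)] c[of S' V', OF S'i] cS cS' by (metis add_right_cancel)
      have "size (content [] (S(i := V)) + {#x#}) = Suc w" using c[of S V, OF S(2)] cS Suc.prems(5) by metis
      then show "size (content [] (S(i := V))) = w" by simp
      show "w > 0" using w by simp
      show "roomy ?m w" if "w \<ge> 2" using roomy_reduce[OF roomy that sum i(1) mi i(2)] by simp
      show "2 * w\<^sup>2 + 10 * w \<le> n - (4 * Suc w + 8) + 10"
        using Suc.prems(8) w by (simp add: power2_eq_square)
    qed
    moreover have "(S(i := V))(i := (S(i := V)) i @ [x]) = S"
      "(S'(i := V'))(i := (S'(i := V')) i @ [x]) = S'"
      using S(2) S'i by auto
    ultimately have 2: "reach m (n - (4 * Suc w + 8)) [] S [] S'"
      using reach_extend_bottom[where x = x and m = m and i = i, OF _ mi] by metis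
    show ?thesis
      by (rule reach_mono[OF reach_trans[OF reach_sym[OF S'(1) fits'] reach_trans[OF 2 S(1)]]])
        (use Suc.prems(8) w in \<open>simp add: power2_eq_square\<close>)
  qed
qed

lemma empty_headshunt:
  assumes "fits m H T" "size (content H T) \<le> sum m I" "only_sidings m"
  shows "\<exists>T'. reach m (length H) H T [] T'"
  using assms
proof (induction H arbitrary: T rule: rev_induct)
  case Nil
  then show ?case using reach.refl by blast
next
  case (snoc x H)
  have "\<exists>k\<in>I. length (T k) < m k"
  proof (rule ccontr)
    assume "\<not> ?thesis"
    then have "sum m I \<le> (\<Sum>i\<in>I. length (T i))" by (intro sum_mono) (auto simp: not_less)
    then show False using snoc.prems(2) by (simp add: size_content)
  qed
  then obtain k where k: "length (T k) < m k" by blast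
  have 1: "reach m 1 (H @ [x]) T H (T(k := [x] @ T k))"
    by (rule reach_push) (use k snoc.prems(1) in \<open>auto simp: fits_def\<close>)
  have "size (content H (T(k := [x] @ T k))) \<le> sum m I"
    unfolding content_reach[OF 1 snoc.prems(1,3)] by (rule snoc.prems(2))
  from snoc.IH[OF fits_reach[OF 1 snoc.prems(1)] this snoc.prems(3)]
  obtain T' where "reach m (length H) H (T(k := [x] @ T k)) [] T'" by blast
  from reach_trans[OF this 1] show ?case by (auto intro: exI[of _ T'])
qed

text \<open>Emptying the headshunt at either end costs at most \<open>w\<close> moves, which
  accounts for the additional \<open>2 * w\<close>.\<close>

lemma connected:
  assumes fits: "fits m H T" "fits m H' T'" and m: "only_sidings m"
    and content: "content H' T' = content H T" "size (content H T) = w"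
    and w: "w > 0" "w \<le> sum m I" "w \<ge> 2 \<Longrightarrow> roomy m w"
  shows "reach m (2 * w\<^sup>2 + 12 * w - 10) H T H' T'"
proof -
  obtain S where S: "reach m (length H) H T [] S"
    using empty_headshunt[OF fits(1) _ m] content w by auto
  obtain S' where S': "reach m (length H') H' T' [] S'"
    using empty_headshunt[OF fits(2) _ m] content w by auto
  have 1: "reach m (2 * w\<^sup>2 + 10 * w - 10) [] S [] S'"
    by (rule connected_empty_headshunt[where w = w])
      (use fits_reach[OF S fits(1)] fits_reach[OF S' fits(2)] content_reach[OF S fits(1) m]
        content_reach[OF S' fits(2) m] m content w in auto)
  have "length H \<le> w" "length H' \<le> w"
    using content size_content[of H T] size_content[of H' T'] by auto
  moreover have "w\<^sup>2 \<ge> 1" using w by simp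
  ultimately show ?thesis
    by (intro reach_mono[OF reach_trans[OF reach_sym[OF S' fits(2)] reach_trans[OF 1 S]]])
      (use w in simp)
qed

end

section \<open>Inglenook puzzles\<close>

lemma walk_of_relpowp:
  assumes "(R ^^ k) p q"
  shows "\<exists>ps. ps \<noteq> [] \<and> successively R ps \<and> hd ps = p \<and> last ps = q \<and> length ps = k + 1"
  using assms
proof (induction k arbitrary: q)
  case 0
  then show ?case by (intro exI[of _ "[p]"]) auto
next
  case (Suc k)
  then obtain q' where q': "(R ^^ k) p q'" "R q' q" by auto
  from Suc.IH[OF q'(1)] obtain ps where
    "ps \<noteq> []" "successively R ps" "hd ps = p" "last ps = q'" "length ps = k + 1" by blast
  then show ?case using q'(2) by (intro exI[of _ "ps @ [q]"]) (auto simp: successively_append_iff)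
qed

text \<open>Cutting out the loop between two occurrences of a vertex shortens the walk;
  \<open>inglenook_path\<close> demands distinct vertices.\<close>

lemma distinct_walk:
  assumes "ps \<noteq> []" "successively R ps"
  shows "\<exists>qs. qs \<noteq> [] \<and> distinct qs \<and> successively R qs \<and> hd qs = hd ps \<and> last qs = last ps \<and>
    length qs \<le> length ps"
  using assms
proof (induction "length ps" arbitrary: ps rule: less_induct)
  case less
  show ?case
  proof (cases "distinct ps")
    case True
    then show ?thesis using less.prems by blast
  next
    case False
    then obtain xs ys zs y where ps: "ps = xs @ [y] @ ys @ [y] @ zs"
      using not_distinct_decomp by blast
    let ?qs = "xs @ [y] @ zs"
    have "successively R ?qs"
      using less.prems(2) unfolding ps by (auto simp: successively_append_iff successively_Cons)
    moreover have "hd ?qs = hd ps" "last ?qs = last ps" by (auto simp: ps hd_append)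
    moreover have "length ?qs < length ps" by (simp add: ps)
    ultimately show ?thesis using less.hyps[of ?qs] by fastforce
  qed
qed

lemma moveI:
  assumes "p \<in> positions P" "q \<in> positions P" "p \<noteq> q" "r \<in> {1..num_sidings P}"
    and "\<And>i. i \<in> {1..num_sidings P} \<Longrightarrow> i \<noteq> r \<Longrightarrow> p ! i = q ! i" "p ! 0 @ p ! r = q ! 0 @ q ! r"
  shows "move P p q"
  unfolding move_def using assms by (intro conjI bexI[of _ r]) auto

lemma path_of_moves:
  assumes "(move P ^^ k) p q" "p \<in> positions P"
  shows "\<exists>ps. inglenook_path P ps \<and> hd ps = p \<and> last ps = q \<and> num_moves ps \<le> k"
proof -
  obtain ps where ps: "ps \<noteq> []" "distinct ps" "successively (move P) ps" "hd ps = p" "last ps = q"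
      "length ps \<le> k + 1"
    using walk_of_relpowp[OF assms(1)] distinct_walk by (metis (no_types, lifting))
  have "set ps \<subseteq> positions P"
    using ps(1,3) assms(2)[folded ps(4)]
  proof (induction ps)
    case (Cons p ps)
    then show ?case by (cases ps) (auto simp: move_def)
  qed simp
  then show ?thesis using ps by (auto simp: inglenook_path_def num_moves_def intro!: exI[of _ ps])
qed

section \<open>Translation between positions and yards\<close>

definition position_of :: "nat \<Rightarrow> 'a list \<Rightarrow> (nat \<Rightarrow> 'a list) \<Rightarrow> 'a position" where
  "position_of s H T = H # map T [1..<Suc s]"

lemma length_position_of [simp]: "length (position_of s H T) = s + 1"
  by (simp add: position_of_def del: upt_Suc)

lemma position_of_nth_0 [simp]: "position_of s H T ! 0 = H"
  by (simp add: position_of_def)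

lemma position_of_nth [simp]: "i \<in> {1..s} \<Longrightarrow> position_of s H T ! i = T i"
  by (cases i) (auto simp: position_of_def simp del: upt_Suc)

lemma mset_concat_position_of:
  "mset (concat (position_of s H T)) = mset H + (\<Sum>i\<in>{1..s}. mset (T i))"
  by (simp add: position_of_def mset_concat comp_def sum_list_distinct_conv_sum_set
      atLeastLessThanSuc_atLeastAtMost del: upt_Suc)

text \<open>Set to 0 off the sidings, as \<open>only_sidings\<close> demands; \<open>siding\<close>
  is padded with \<open>[]\<close> to match.\<close>

definition capacity :: "'a puzzle \<Rightarrow> nat \<Rightarrow> nat" where
  "capacity P i = (if i \<in> {1..num_sidings P} then siding_length P i else 0)"

definition siding :: "'a position \<Rightarrow> nat \<Rightarrow> 'a list" where
  "siding p i = (if i \<in> {1..<length p} then p ! i else [])"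

lemma position_of_siding:
  assumes "length p = s + 1"
  shows "position_of s (p ! 0) (siding p) = p"
proof (rule nth_equalityI)
  fix i assume "i < length (position_of s (p ! 0) (siding p))"
  then show "position_of s (p ! 0) (siding p) ! i = p ! i"
    using assms by (cases "i = 0") (auto simp: siding_def)
qed (simp add: assms)

lemma distinct_iff_mset_set:
  assumes "finite A"
  shows "distinct xs \<and> set xs = A \<longleftrightarrow> mset xs = mset_set A"
proof
  assume "mset xs = mset_set A"
  then show "distinct xs \<and> set xs = A"
    using assms by (metis distinct_count_atmost_1 count_mset_set set_mset_mset finite_set_mset_mset_set)
qed (auto simp: mset_set_set)

lemma distinct_concat_nth_disjoint:
  assumes "distinct (concat xss)" "i < length xss" "j < length xss" "i \<noteq> j"
  shows "set (xss ! i) \<inter> set (xss ! j) = {}"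
proof -
  have *: "set (xss ! i) \<inter> set (xss ! j) = {}" if "i < j" "j < length xss" for i j
  proof -
    have "xss ! j \<in> set (drop (Suc i) xss)"
      using that by (auto simp: in_set_conv_nth intro!: exI[of _ "j - Suc i"])
    moreover have "distinct (concat (take i xss @ xss ! i # drop (Suc i) xss))"
      using assms(1) that by (simp flip: id_take_nth_drop)
    ultimately show ?thesis by fastforce
  qed
  show ?thesis using *[of i j] *[of j i] assms by (cases "i < j") auto
qed

locale inglenook =
  fixes P :: "'a puzzle"
  assumes puzzle: "inglenook_puzzle P"
begin

declare One_nat_def [simp del]

abbreviation "sidings \<equiv> {1..num_sidings P}"
abbreviation "total_length \<equiv> \<Sum>i=1..num_sidings P. siding_length P i"

sublocale yard sidings "headshunt_length P"
  using puzzle by unfold_locales (auto simp: inglenook_puzzle_def)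

lemma finite_wagons: "finite (wagons P)"
  using puzzle by (simp add: inglenook_puzzle_def)

lemma siding_length_pos: "i \<in> sidings \<Longrightarrow> siding_length P i > 0"
  using puzzle by (simp add: inglenook_puzzle_def)

lemma only_sidings_capacity: "only_sidings (capacity P)"
  by (auto simp: only_sidings_def capacity_def)

lemma sum_capacity: "sum (capacity P) sidings = total_length"
  by (rule sum.cong) (auto simp: capacity_def)

lemma roomy_capacity:
  "roomy (capacity P) w \<longleftrightarrow> (\<forall>i\<in>sidings. w + 1 + siding_length P i \<le> headshunt_length P + total_length) \<and>
     2 \<le> num_sidings P \<and> 4 \<le> headshunt_length P + num_sidings P"
proof -
  have "{i\<in>sidings. capacity P i > 0} = sidings"
    using siding_length_pos by (auto simp: capacity_def)
  then show ?thesis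
    by (simp add: roomy_def sum_capacity) (auto simp: capacity_def)
qed

lemma position_of_mem:
  assumes "fits (capacity P) H T" "content H T = mset_set (wagons P)"
  shows "position_of (num_sidings P) H T \<in> positions P"
proof -
  let ?p = "position_of (num_sidings P) H T"
  have "mset (concat ?p) = mset_set (wagons P)"
    using assms(2) by (simp add: mset_concat_position_of content_def)
  then have "distinct (concat ?p) \<and> set (concat ?p) = wagons P"
    using distinct_iff_mset_set[OF finite_wagons] by blast
  moreover have "length (?p ! i) \<le> siding_length P i" if "i \<in> sidings" for i
    using fits_siding[OF assms(1), of i] that by (auto simp: capacity_def)
  ultimately show ?thesis using assms(1) by (auto simp: positions_def fits_def)
qed

lemma position_siding:
  assumes "p \<in> positions P"
  shows "position_of (num_sidings P) (p ! 0) (siding p) = p"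
    and "fits (capacity P) (p ! 0) (siding p)"
    and "content (p ! 0) (siding p) = mset_set (wagons P)"
proof -
  show 1: "position_of (num_sidings P) (p ! 0) (siding p) = p"
    using assms by (intro position_of_siding) (simp add: positions_def)
  show "fits (capacity P) (p ! 0) (siding p)"
    using assms by (auto simp: fits_def capacity_def siding_def positions_def)
  have "mset (concat p) = mset_set (wagons P)"
    using assms distinct_iff_mset_set[OF finite_wagons, of "concat p"] by (simp add: positions_def)
  then show "content (p ! 0) (siding p) = mset_set (wagons P)"
    using mset_concat_position_of[of "num_sidings P" "p ! 0" "siding p"] 1
    by (simp add: content_def)
qed

text \<open>A step of \<open>reach\<close> may leave the position unchanged, whereas
  \<open>move\<close> relates distinct positions; hence \<open>k \<le> n\<close> rather than
  equality.\<close>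

lemma moves_of_reach:
  assumes "reach (capacity P) n H T H' T'" "fits (capacity P) H T"
    "content H T = mset_set (wagons P)"
  shows "\<exists>k\<le>n. (move P ^^ k) (position_of (num_sidings P) H T) (position_of (num_sidings P) H' T')"
  using assms
proof (induction rule: reach.induct)
  case (refl n H T)
  then show ?case by (intro exI[of _ 0]) simp
next
  case (step n H T H' T' r H'' t)
  let ?pos = "position_of (num_sidings P)"
  from step.IH[OF step.prems] obtain k where k: "k \<le> n" "(move P ^^ k) (?pos H T) (?pos H' T')"
    by blast
  have fits: "fits (capacity P) H' T'" and content: "content H' T' = mset_set (wagons P)"
    using fits_reach[OF step.hyps(1) step.prems(1)]
      content_reach[OF step.hyps(1) step.prems(1) only_sidings_capacity] step.prems(2) by auto
  have last: "reach (capacity P) 1 H' T' H'' (T'(r := t))"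
    using reach.step[OF reach.refl[of "capacity P" 0 H' T'], of r H'' t] step.hyps(2-4)
    by (simp add: One_nat_def)
  have fits': "fits (capacity P) H'' (T'(r := t))"
    and content': "content H'' (T'(r := t)) = mset_set (wagons P)"
    using fits_reach[OF last fits] content_reach[OF last fits only_sidings_capacity] content by auto
  have "?pos H'' (T'(r := t)) = ?pos H' T' \<or> move P (?pos H' T') (?pos H'' (T'(r := t)))"
  proof (cases "r \<in> sidings")
    case True
    then show ?thesis
      using moveI[OF position_of_mem[OF fits content] position_of_mem[OF fits' content'], of r]
        step.hyps(2) by (cases "?pos H' T' = ?pos H'' (T'(r := t))") auto
  next
    case False
    then have "capacity P r = 0" by (auto simp: capacity_def)
    then have "t = []" "T' r = []" using step.hyps(4) fits_siding[OF fits, of r] by auto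
    then have "H'' = H'" "T'(r := t) = T'" using step.hyps(2) by auto
    then show ?thesis by simp
  qed
  then show ?case
  proof
    assume "?pos H'' (T'(r := t)) = ?pos H' T'"
    then show ?case using k by (metis le_SucI)
  next
    assume "move P (?pos H' T') (?pos H'' (T'(r := t)))"
    then show ?case using relpowp_Suc_I[OF k(2)] k(1) by (metis Suc_le_mono)
  qed
qed

lemma path_between_positions:
  assumes "p \<in> positions P" "q \<in> positions P"
    and w: "w = card (wagons P)" "w \<le> total_length" "w \<ge> 2 \<Longrightarrow> roomy (capacity P) w"
  shows "\<exists>ps. inglenook_path P ps \<and> hd ps = p \<and> last ps = q \<and>
    num_moves ps \<le> 2 * w\<^sup>2 + 12 * w - 10"
proof -
  note p = position_siding[OF assms(1)] and q = position_siding[OF assms(2)]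
  have "w > 0" using puzzle w(1) by (simp add: inglenook_puzzle_def)
  then have "reach (capacity P) (2 * w\<^sup>2 + 12 * w - 10) (p ! 0) (siding p) (q ! 0) (siding q)"
    by (intro connected) (use p q w only_sidings_capacity sum_capacity finite_wagons in simp_all)
  from moves_of_reach[OF this p(2,3)] obtain k where
    k: "k \<le> 2 * w\<^sup>2 + 12 * w - 10" "(move P ^^ k) p q"
    unfolding p(1) q(1) by blast
  obtain ps where "inglenook_path P ps" "hd ps = p" "last ps = q" "num_moves ps \<le> k"
    using path_of_moves[OF k(2) assms(1)] by blast
  then show ?thesis using k(1) by (intro exI[of _ ps]) simp
qed

section \<open>Stuck wagons in natural puzzles\<close>

lemma move_invariant_path:
  assumes "successively (move P) ps" "ps \<noteq> []" "\<And>p q. move P p q \<Longrightarrow> g p = g q"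
  shows "g (hd ps) = g (last ps)"
  using assms(1,2)
proof (induction ps)
  case step: (Cons p ps)
  show ?case
  proof (cases ps)
    case (Cons q qs)
    then have "g p = g q" using step.prems assms(3)[of p q] by simp
    then show ?thesis using step.IH step.prems Cons by simp
  qed simp
qed simp

text \<open>Exchange \<open>a\<close> with the first wagon of \<open>L p\<close> in the starting position.\<close>

lemma natural_invariant:
  assumes "natural P" "always_solvable P" "p \<in> starts P"
    and equivariant: "\<And>p f. p \<in> positions P \<Longrightarrow> L (map (map f) p) = map f (L p)"
    and L: "\<And>p. p \<in> positions P \<Longrightarrow> L p \<noteq> [] \<and> set (L p) \<subseteq> wagons P"
    and invariant: "\<And>p q. move P p q \<Longrightarrow> hd (L p) = hd (L q)"
    and a: "a \<in> wagons P"
  shows "\<exists>q\<in>finishes P. q \<in> positions P \<and> hd (L q) = a"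
proof -
  have p: "p \<in> positions P" using assms(3) puzzle by (auto simp: inglenook_puzzle_def)
  define c where "c = hd (L p)"
  have c: "c \<in> wagons P" using L[OF p] unfolding c_def by (meson hd_in_set subsetD)
  define f where "f = id(c := a, a := c)"
  have "bij_betw f (wagons P) (wagons P)"
    by (rule bij_betw_byWitness[where f' = f]) (use a c in \<open>auto simp: f_def\<close>)
  then have "map (map f) p \<in> starts P" using assms(1,3) by (simp add: natural_def)
  then obtain ps where ps: "solution P (map (map f) p) ps"
    using assms(2) by (auto simp: always_solvable_def)
  then have "hd (L (map (map f) p)) = hd (L (last ps))"
    using move_invariant_path[of ps "\<lambda>p. hd (L p)"] invariant
    by (auto simp: solution_def inglenook_path_def)
  moreover have "hd (L (map (map f) p)) = a"
    using equivariant[OF p] L[OF p] by (simp add: hd_map c_def[symmetric] f_def)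
  moreover have "last ps \<in> finishes P" using ps by (simp add: solution_def)
  ultimately show ?thesis using puzzle by (auto simp: inglenook_puzzle_def)
qed

lemma siding_load:
  assumes "p \<in> positions P" "i \<in> sidings"
  shows "card (wagons P) + siding_length P i \<le> length (p ! 0) + length (p ! i) + total_length"
proof -
  note p = position_siding[OF assms(1)]
  have "card (wagons P) = length (p ! 0) + (\<Sum>j\<in>sidings. length (siding p j))"
    using p(3) size_content[of "p ! 0" "siding p"] by simp
  moreover have "(\<Sum>j\<in>sidings - {i}. length (siding p j)) \<le> sum (siding_length P) (sidings - {i})"
    by (rule sum_mono) (use assms(1) in \<open>auto simp: siding_def positions_def\<close>)
  moreover have "siding p i = p ! i" using assms by (auto simp: siding_def positions_def)
  ultimately show ?thesis
    using sum.remove[OF finite_sidings assms(2), of "siding_length P"]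
      sum.remove[OF finite_sidings assms(2), of "\<lambda>j. length (siding p j)"] by simp
qed

lemma headshunt_load:
  assumes "p \<in> positions P"
  shows "card (wagons P) \<le> length (p ! 0) + total_length"
proof -
  have "1 \<in> sidings" using puzzle by (simp add: inglenook_puzzle_def)
  moreover from this have "length (p ! 1) \<le> siding_length P 1"
    using assms by (simp add: positions_def)
  ultimately show ?thesis using siding_load[OF assms, of 1] by simp
qed

lemma set_track:
  assumes "p \<in> positions P" "i \<le> num_sidings P"
  shows "set (p ! i) \<subseteq> wagons P"
proof -
  have "p ! i \<in> set p" using assms by (simp add: positions_def)
  then show ?thesis using assms by (auto simp: positions_def)
qed

lemma tracks_disjoint:
  assumes "p \<in> positions P" "i \<le> num_sidings P" "j \<le> num_sidings P" "i \<noteq> j"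
  shows "set (p ! i) \<inter> set (p ! j) = {}"
  by (rule distinct_concat_nth_disjoint) (use assms in \<open>auto simp: positions_def\<close>)

context
  assumes natural: "natural P" and solvable: "always_solvable P" and starts: "starts P \<noteq> {}"
begin

text \<open>Otherwise the headshunt is never empty, and its first wagon is stuck because a move
  preserves the line from the engine. Choosing that wagon to be \<open>\<omega>\<close> puts
  \<open>\<omega>\<close> on two tracks of a finishing position.\<close>

lemma natural_fits_sidings: "card (wagons P) \<le> total_length"
proof (rule ccontr)
  assume "\<not> ?thesis"
  then have ne: "p ! 0 \<noteq> []" if "p \<in> positions P" for p
    using headshunt_load[OF that] by auto
  obtain p where p: "p \<in> starts P" using starts by blast
  obtain z \<omega> where z: "z \<in> sidings" "\<omega> \<in> wagons P"
    "\<And>q. q \<in> finishes P \<Longrightarrow> q ! z \<noteq> [] \<and> last (q ! z) = \<omega>"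
    using natural unfolding natural_def by blast
  have inv: "hd (p ! 0) = hd (q ! 0)" if move: "move P p q" for p q
  proof -
    obtain r where "p ! 0 @ p ! r = q ! 0 @ q ! r" using move by (auto simp: move_def)
    then show ?thesis using ne[of p] ne[of q] move by (metis hd_append2 move_def)
  qed
  have "map (map f) p ! 0 = map f (p ! 0)" if "p \<in> positions P" for p and f :: "'a \<Rightarrow> 'a"
    using that by (auto simp: positions_def)
  then obtain q where q: "q \<in> finishes P" "q \<in> positions P" "hd (q ! 0) = \<omega>"
    using natural_invariant[OF natural solvable p, of "\<lambda>p. p ! 0" \<omega>] ne set_track[of _ 0] inv z(2)
    by auto
  have "\<omega> \<in> set (q ! 0) \<inter> set (q ! z)" using z(3)[OF q(1)] q(3) ne[OF q(2)] by (metis IntI hd_in_set last_in_set)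
  then show False using tracks_disjoint[OF q(2), of 0 z] z(1) by auto
qed

lemma ex_other_wagon:
  assumes "card (wagons P) \<ge> 2"
  shows "\<exists>a\<in>wagons P. a \<noteq> \<omega>"
proof (rule ccontr)
  assume "\<not> ?thesis"
  then have "wagons P \<subseteq> {\<omega>}" by auto
  from card_mono[OF _ this] show False using assms by simp
qed

lemma natural_no_siding_invariant:
  assumes w: "card (wagons P) \<ge> 2" and i: "i \<in> sidings"
    and ne: "\<And>p. p \<in> positions P \<Longrightarrow> p ! 0 @ p ! i \<noteq> []"
    and inv: "\<And>p q. move P p q \<Longrightarrow> last (p ! 0 @ p ! i) = last (q ! 0 @ q ! i)"
  shows False
proof -
  obtain p where p: "p \<in> starts P" using starts by blast
  obtain z \<omega> where z: "z \<in> sidings" "\<omega> \<in> wagons P"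
    "\<And>q. q \<in> finishes P \<Longrightarrow> q ! z \<noteq> [] \<and> last (q ! z) = \<omega>"
    using natural unfolding natural_def by blast
  obtain b where b: "b \<in> wagons P" "b \<noteq> \<omega>" using ex_other_wagon[OF w] by blast
  \<comment> \<open>For \<open>i = z\<close> the last wagon of siding \<open>z\<close> in a
    finishing position is \<open>\<omega>\<close>, so the stuck wagon is chosen different from it.
    For other \<open>i\<close> it is chosen to be \<open>\<omega>\<close>, which then stands in the
    headshunt or on siding \<open>i\<close> instead of \<open>z\<close>.\<close>
  define a where "a = (if i = z then b else \<omega>)"
  let ?L = "\<lambda>p. rev (p ! 0 @ p ! i)"
  have "\<exists>q\<in>finishes P. q \<in> positions P \<and> hd (?L q) = a"
  proof (rule natural_invariant[OF natural solvable p])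
    show "?L (map (map f) p) = map f (?L p)" if "p \<in> positions P" for p f
      using that i by (auto simp: positions_def rev_map)
    show "?L p \<noteq> [] \<and> set (?L p) \<subseteq> wagons P" if "p \<in> positions P" for p
      using ne[OF that] set_track[OF that, of 0] set_track[OF that, of i] i by auto
    show "hd (?L p) = hd (?L q)" if "move P p q" for p q
      using inv[OF that] by (simp add: hd_rev del: rev_append)
    show "a \<in> wagons P" using b z by (simp add: a_def)
  qed
  then obtain q where q: "q \<in> finishes P" "q \<in> positions P" "last (q ! 0 @ q ! i) = a"
    by (auto simp: hd_rev simp del: rev_append)
  show False
  proof (cases "i = z")
    case True
    then show ?thesis using q z(3)[OF q(1)] b by (simp add: a_def)
  next
    case False
    then have "\<omega> \<in> set (q ! 0 @ q ! i)" using q(3) ne[OF q(2)] by (metis a_def last_in_set)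
    moreover have "\<omega> \<in> set (q ! z)" using z(3)[OF q(1)] by (metis last_in_set)
    ultimately show ?thesis
      using tracks_disjoint[OF q(2), of 0 z] tracks_disjoint[OF q(2), of i z] z(1) i False by auto
  qed
qed

text \<open>If this fails, siding \<open>i\<close> can be empty only while the headshunt is full. A
  move at another siding then keeps the last wagon of \<open>p ! 0 @ p ! i\<close>: either siding
  \<open>i\<close> is nonempty and untouched, or the headshunt is full before and after and hence
  unchanged.\<close>

lemma natural_siding_clearable:
  assumes "card (wagons P) \<ge> 2" "i \<in> sidings"
  shows "card (wagons P) + 1 + siding_length P i \<le> headshunt_length P + total_length"
proof (rule ccontr)
  assume less: "\<not> ?thesis"
  show False
  proof (rule natural_no_siding_invariant[OF assms])
    fix p assume "p \<in> positions P"
    from siding_load[OF this assms(2)] show "p ! 0 @ p ! i \<noteq> []"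
      using less headshunt_pos by auto
  next
    fix p q assume move: "move P p q"
    then obtain r where r: "p ! 0 @ p ! r = q ! 0 @ q ! r" "r \<noteq> i \<Longrightarrow> p ! i = q ! i"
      using assms(2) by (auto simp: move_def)
    have pos: "p \<in> positions P" "q \<in> positions P" using move by (auto simp: move_def)
    have full: "length (u ! 0) = headshunt_length P" if "u \<in> positions P" "u ! i = []" for u
      using siding_load[OF that(1) assms(2)] that less by (auto simp: positions_def)
    show "last (p ! 0 @ p ! i) = last (q ! 0 @ q ! i)"
    proof (cases "r = i \<or> p ! i \<noteq> []")
      case True
      then show ?thesis using r by (cases "r = i") simp_all
    next
      case False
      then have "length (p ! 0) = length (q ! 0)" using r(2) full pos by metis
      then have "p ! 0 = q ! 0" using r(1) by simp
      then show ?thesis using r(2) False by simp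
    qed
  qed
qed

text \<open>Two kinds of yards are excluded because the order of the wagons is frozen there: a
  single siding, where \<open>p ! 0 @ p ! 1\<close> never changes, and two sidings with a headshunt
  of length 1.\<close>

lemma natural_enough_tracks:
  assumes "card (wagons P) \<ge> 2"
  shows "2 \<le> num_sidings P \<and> 4 \<le> headshunt_length P + num_sidings P"
proof (rule ccontr)
  assume less: "\<not> ?thesis"
  have pos: "headshunt_length P > 0" "num_sidings P > 0"
    using puzzle by (auto simp: inglenook_puzzle_def)
  consider "num_sidings P = 1" | "num_sidings P = 2" "headshunt_length P = 1"
    using less pos by linarith
  then show False
  proof cases
    case 1
    show False
    proof (rule natural_no_siding_invariant[OF assms])
      show "1 \<in> sidings" using 1 by simp
      fix p assume p: "p \<in> positions P"
      have "length p = 2" using p 1 by (simp add: positions_def)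
      then have "concat p = p ! 0 @ p ! 1"
        by (auto simp: length_Suc_conv numeral_2_eq_2 One_nat_def)
      moreover have "wagons P \<noteq> {}" using assms by auto
      then have "concat p \<noteq> []" using p by (metis (mono_tags, lifting) mem_Collect_eq positions_def list.set(1))
      ultimately show "p ! 0 @ p ! 1 \<noteq> []" by simp
    next
      fix p q assume "move P p q"
      then show "last (p ! 0 @ p ! 1) = last (q ! 0 @ q ! 1)"
        using 1 by (auto simp: move_def)
    qed
  next
    case 2
    obtain p where p: "p \<in> starts P" using starts by blast
    obtain z \<omega> where z: "z \<in> sidings" "\<omega> \<in> wagons P"
      "\<And>q. q \<in> finishes P \<Longrightarrow> q ! z \<noteq> [] \<and> last (q ! z) = \<omega>"
      using natural unfolding natural_def by blast
    obtain a where a: "a \<in> wagons P" "a \<noteq> \<omega>" using ex_other_wagon[OF assms] by blast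
    \<comment> \<open>The other one of the sidings 1 and 2.\<close>
    define y where "y = 3 - z"
    have yz: "y = 1 \<and> z = 2 \<or> y = 2 \<and> z = 1" using z(1) 2 by (auto simp: y_def)
    then have y: "y \<in> sidings" "sidings = {y, z}" "y \<noteq> z" using 2 by auto
    text \<open>With a headshunt for a single wagon, the whole line of wagons from one buffer stop to the
      other is invariant.\<close>
    let ?L = "\<lambda>p. rev (rev (p ! y) @ p ! 0 @ p ! z)"
    \<comment> \<open>At most one wagon is in the headshunt, so it reads the same in both directions
      and moves at siding \<open>y\<close> also preserve the line.\<close>
    have rev0: "rev (u ! 0) = u ! 0" if "u \<in> positions P" for u
    proof -
      have "length (u ! 0) \<le> 1" using that 2 by (simp add: positions_def)
      then show ?thesis by (cases "u ! 0") auto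
    qed
    have "\<exists>q\<in>finishes P. q \<in> positions P \<and> hd (?L q) = a"
    proof (rule natural_invariant[OF natural solvable p _ _ _ a(1)])
      show "?L (map (map f) p) = map f (?L p)" if "p \<in> positions P" for p f
        using that y(1) z(1) by (auto simp: positions_def rev_map)
      show "?L p \<noteq> [] \<and> set (?L p) \<subseteq> wagons P" if "p \<in> positions P" for p
      proof -
        have "length p = Suc (Suc (Suc 0))" using that 2 by (simp add: positions_def)
        then have "set p = {p ! 0, p ! 1, p ! 2}"
          by (auto simp: length_Suc_conv numeral_2_eq_2 One_nat_def)
        then have "set (concat p) = set (?L p)" using yz by auto
        then have "set (?L p) = wagons P" using that by (simp add: positions_def)
        then show ?thesis using a by fastforce
      qed
      show "hd (?L p) = hd (?L q)" if move: "move P p q" for p q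
      proof -
        have pq: "p \<in> positions P" "q \<in> positions P" using move by (auto simp: move_def)
        obtain r where r: "r \<in> {y, z}" "\<forall>i\<in>{y, z} - {r}. p ! i = q ! i" "p ! 0 @ p ! r = q ! 0 @ q ! r"
          using move y(2) by (auto simp: move_def)
        show ?thesis
        proof (cases "r = z")
          case True
          then show ?thesis using r y(3) by auto
        next
          case False
          then have "r = y" using r(1) by simp
          then have "rev (p ! y) @ p ! 0 = rev (q ! y) @ q ! 0"
            using r(3) rev0[OF pq(1)] rev0[OF pq(2)] by (metis rev_append)
          then show ?thesis using r(2) \<open>r = y\<close> y(3) by (metis append_assoc insertCI Diff_iff singletonD)
        qed
      qed
    qed
    then obtain q where q: "q \<in> finishes P" "hd (?L q) = a" by blast
    then show False using z(3)[OF q(1)] a by (simp add: hd_append hd_rev)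
  qed
qed

text \<open>The given solution serves to exhibit a finishing position; the short path to it comes
  from connectedness.\<close>

lemma natural_short_solution:
  assumes "p \<in> starts P" and w: "w = card (wagons P)"
  shows "\<exists>ps. solution P p ps \<and> num_moves ps \<le> 2 * w\<^sup>2 + 12 * w - 10"
proof -
  obtain qs where "solution P p qs" using solvable assms(1) by (auto simp: always_solvable_def)
  then have q: "last qs \<in> finishes P" by (simp add: solution_def)
  have "p \<in> positions P" "last qs \<in> positions P"
    using assms(1) q puzzle by (auto simp: inglenook_puzzle_def)
  moreover have "roomy (capacity P) w" if "w \<ge> 2"
    using natural_siding_clearable natural_enough_tracks w that by (simp add: roomy_capacity)
  ultimately have "\<exists>ps. inglenook_path P ps \<and> hd ps = p \<and> last ps = last qs \<and>
      num_moves ps \<le> 2 * w\<^sup>2 + 12 * w - 10"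
    using path_between_positions[OF _ _ w] natural_fits_sidings w by blast
  then show ?thesis using q by (auto simp: solution_def)
qed

end

end

section \<open>A puzzle that needs many moves\<close>

fun inversions :: "nat list \<Rightarrow> nat" where
  "inversions [] = 0"
| "inversions (x # xs) = length (filter (\<lambda>y. y < x) xs) + inversions xs"

lemma inversions_sorted: "sorted xs \<Longrightarrow> inversions xs = 0"
  by (induction xs) (auto simp: filter_empty_conv not_less)

lemma inversions_rev_upt: "2 * inversions (rev [0..<n]) = n * (n - 1)"
proof (induction n)
  case (Suc n)
  have "filter (\<lambda>y. y < n) (rev [0..<n]) = rev [0..<n]" by (simp add: filter_id_conv)
  then have "inversions (rev [0..<Suc n]) = n + inversions (rev [0..<n])" by simp
  then have "2 * inversions (rev [0..<Suc n]) = 2 * n + n * (n - 1)"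
    using Suc by simp
  then show ?case by (cases n) auto
qed simp

lemma inversions_swap: "inversions (xs @ a # b # ys) \<le> inversions (xs @ b # a # ys) + 1"
  by (induction xs) auto

text \<open>Moving \<open>t\<close> from the headshunt \<open>K @ t\<close> onto a siding replaces
  \<open>K @ t\<close> by \<open>rev t @ K\<close> in the line. With at most two wagons involved
  this is the identity or one adjacent transposition.\<close>

lemma inversions_shunt:
  assumes "length H \<le> 2" "length H' \<le> 2" "H @ W = H' @ W'"
  shows "inversions (rev W @ H @ C) \<le> inversions (rev W' @ H' @ C) + 1"
proof -
  have *: "inversions (rev (t @ V) @ K @ C) \<le> inversions (rev V @ (K @ t) @ C) + 1 \<and>
      inversions (rev V @ (K @ t) @ C) \<le> inversions (rev (t @ V) @ K @ C) + 1"
    if len: "length K + length t \<le> 2" for K t V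
  proof -
    consider "t = []" | a where "t = [a]" "K = []" | a b where "t = [a]" "K = [b]"
      | a b where "t = [a, b]" "K = []"
      using len by (cases t; cases "tl t"; cases K; cases "tl K") auto
    then show ?thesis
      by cases (simp_all add: inversions_swap[simplified])
  qed
  from assms(3) consider us where "H = H' @ us" "W' = us @ W" | us where "H' = H @ us" "W = us @ W'"
    by (auto simp: append_eq_append_conv2)
  then show ?thesis
  proof cases
    case 1
    then show ?thesis using *[of H' us W] assms(1) by simp
  next
    case 2
    then show ?thesis using *[of H us W'] assms(2) by simp
  qed
qed

text \<open>Moving wagons across singly reverses their order. Bringing \<open>[0..<w]\<close> from
  siding 1 to siding 2 in the same order thus means reversing the whole line
  \<open>rev W1 W0 W2\<close>.\<close>

definition reversal_puzzle :: "nat \<Rightarrow> nat puzzle" where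
  "reversal_puzzle w = \<lparr>num_sidings = 2, headshunt_length = 2, siding_length = (\<lambda>_. w),
     wagons = {..<w}, starts = {[[], xs, []] |xs. distinct xs \<and> set xs = {..<w}},
     finishes = {[[], [], [0..<w]]}\<rparr>"

text \<open>Moves at siding 2 leave the line unchanged and are charged by the second term, as they
  add at most two wagons to that siding. Moves at siding 1 remove at most one inversion, which
  counts twice. The value is an integer because it ends negative.\<close>

definition potential :: "nat position \<Rightarrow> int" where
  "potential p = 2 * int (inversions (rev (p ! 1) @ p ! 0 @ p ! 2)) - int (length (p ! 2))"

lemma all_sidings_2: "(\<forall>i\<in>{1..2::nat}. Q i) \<longleftrightarrow> Q 1 \<and> Q 2"
proof -
  have "{1..2::nat} = {1, 2}" by auto
  then show ?thesis by simp
qed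

lemma positions_reversal:
  "p \<in> positions (reversal_puzzle w) \<longleftrightarrow> length p = 3 \<and> distinct (concat p) \<and> set (concat p) = {..<w} \<and>
     length (p ! 0) \<le> 2 \<and> length (p ! 1) \<le> w \<and> length (p ! 2) \<le> w"
  by (auto simp: positions_def reversal_puzzle_def all_sidings_2 simp del: One_nat_def)

lemma potential_move:
  assumes "move (reversal_puzzle w) p q"
  shows "potential p \<le> potential q + 2"
proof -
  have len: "length (p ! 0) \<le> 2" "length (q ! 0) \<le> 2"
    using assms by (auto simp: move_def positions_reversal)
  have "{1..2::nat} = {1, 2}" by auto
  then obtain r where r: "r = 1 \<or> r = 2" "\<forall>i\<in>{1, 2} - {r}. p ! i = q ! i"
    "p ! 0 @ p ! r = q ! 0 @ q ! r"
    using assms by (auto simp: move_def reversal_puzzle_def simp del: One_nat_def)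
  from r(1) show ?thesis
  proof
    assume [simp]: "r = 1"
    have "p ! 2 = q ! 2" using r(2) by simp
    then show ?thesis
      using inversions_shunt[OF len, of "p ! 1" "q ! 1" "q ! 2"] r(3) by (simp add: potential_def)
  next
    assume [simp]: "r = 2"
    have "p ! 1 = q ! 1" using r(2) by simp
    moreover have "length (q ! 2) \<le> length (p ! 2) + 2"
      using arg_cong[OF r(3), of length] len by simp
    ultimately show ?thesis using r(3) by (simp add: potential_def)
  qed
qed

lemma potential_path:
  assumes "successively (move (reversal_puzzle w)) ps" "ps \<noteq> []"
  shows "potential (hd ps) \<le> potential (last ps) + 2 * int (num_moves ps)"
  using assms
proof (induction ps)
  case step: (Cons p ps)
  show ?case
  proof (cases ps)
    case Nil
    then show ?thesis by (simp add: num_moves_def)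
  next
    case (Cons q qs)
    then have "potential p \<le> potential q + 2" using step.prems potential_move[of w p q] by simp
    then show ?thesis using step.IH step.prems Cons by (simp add: num_moves_def)
  qed
qed simp

section \<open>The reversal puzzle is natural, solvable and slow\<close>

lemma reversal_puzzle_inglenook:
  assumes "w > 0"
  shows "inglenook_puzzle (reversal_puzzle w)"
proof -
  have "length xs = w" if "distinct xs" "set xs = {..<w}" for xs
    using distinct_card[OF that(1)] that(2) by simp
  then have "starts (reversal_puzzle w) \<subseteq> positions (reversal_puzzle w)"
    "finishes (reversal_puzzle w) \<subseteq> positions (reversal_puzzle w)"
    by (auto simp: positions_reversal) (auto simp: reversal_puzzle_def)
  then show ?thesis
    using assms by (simp add: inglenook_puzzle_def) (simp add: reversal_puzzle_def)
qed

lemma reversal_puzzle_natural: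
  assumes "w > 0"
  shows "natural (reversal_puzzle w)"
  unfolding natural_def
proof (intro conjI allI impI ballI)
  fix f :: "nat \<Rightarrow> nat" and p
  assume f: "bij_betw f (wagons (reversal_puzzle w)) (wagons (reversal_puzzle w))"
    and "p \<in> starts (reversal_puzzle w)"
  then obtain xs where p: "p = [[], xs, []]" "distinct xs" "set xs = {..<w}"
    by (auto simp: reversal_puzzle_def)
  have "bij_betw f {..<w} {..<w}" using f by (simp add: reversal_puzzle_def)
  then have "distinct (map f xs)" "set (map f xs) = {..<w}"
    using p by (auto simp: distinct_map bij_betw_def)
  then show "map (map f) p \<in> starts (reversal_puzzle w)" using p by (simp add: reversal_puzzle_def)
next
  show "\<exists>z\<in>{1..num_sidings (reversal_puzzle w)}. \<exists>\<omega>\<in>wagons (reversal_puzzle w).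
    \<forall>q\<in>finishes (reversal_puzzle w). q ! z \<noteq> [] \<and> last (q ! z) = \<omega>"
    using assms by (intro bexI[of _ 2] bexI[of _ "w - 1"]) (auto simp: reversal_puzzle_def)
qed

lemma reversal_puzzle_solvable:
  assumes "w > 0"
  shows "always_solvable (reversal_puzzle w)"
  unfolding always_solvable_def
proof
  let ?P = "reversal_puzzle w"
  fix p assume p: "p \<in> starts ?P"
  have puzzle: "inglenook_puzzle ?P" using reversal_puzzle_inglenook[OF assms] .
  then interpret inglenook ?P by unfold_locales
  let ?q = "[[], [], [0..<w]]"
  have q: "?q \<in> finishes ?P" by (simp add: reversal_puzzle_def)
  have "p \<in> positions ?P" "?q \<in> positions ?P"
    using p q puzzle by (auto simp: inglenook_puzzle_def)
  \<comment> \<open>The conditions read \<open>2 * w + 1 \<le> 2 + 2 * w\<close>,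
    \<open>2 \<le> 2\<close> and \<open>4 \<le> 2 + 2\<close>.\<close>
  moreover have "roomy (capacity ?P) w"
    by (simp add: roomy_capacity) (simp add: reversal_puzzle_def)
  ultimately show "\<exists>ps. solution ?P p ps"
    using path_between_positions[of p ?q w] q
    by (auto simp: solution_def reversal_puzzle_def)
qed

lemma reversal_puzzle_solution:
  assumes "solution (reversal_puzzle w) [[], [0..<w], []] ps"
  shows "w\<^sup>2 \<le> 2 * num_moves ps"
proof -
  have "last ps = [[], [], [0..<w]]" using assms by (simp add: solution_def reversal_puzzle_def)
  moreover have "hd ps = [[], [0..<w], []]" "ps \<noteq> []" "successively (move (reversal_puzzle w)) ps"
    using assms by (auto simp: solution_def inglenook_path_def)
  \<comment> \<open>The potential is \<open>w * (w - 1)\<close> at the start and \<open>- w\<close>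
    at the finish, so it drops by \<open>w\<^sup>2\<close> in total.\<close>
  ultimately have "2 * int (inversions (rev [0..<w])) + int w \<le> 2 * int (num_moves ps)"
    using potential_path[of w ps] by (simp add: potential_def inversions_sorted)
  then have "2 * inversions (rev [0..<w]) + w \<le> 2 * num_moves ps" by linarith
  moreover have "w\<^sup>2 = w * (w - 1) + w" by (cases w) (auto simp: power2_eq_square)
  ultimately show ?thesis unfolding inversions_rev_upt by linarith
qed

theorem theorem7:
  fixes w :: nat
  assumes "w > 0"
  shows "(\<forall>P :: 'a puzzle.
            inglenook_puzzle P \<and> natural P \<and> card (wagons P) = w \<and> always_solvable P \<longrightarrow>
            (\<forall>p\<in>starts P. \<exists>ps. solution P p ps \<and>
               real (num_moves ps) \<le> 2 * real w ^ 2 + 12 * real w - 10)) \<and>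
         (\<exists>P :: nat puzzle.
            inglenook_puzzle P \<and> natural P \<and> card (wagons P) = w \<and> always_solvable P \<and>
            (\<exists>p\<in>starts P. \<forall>ps. solution P p ps \<longrightarrow>
               real (num_moves ps) \<ge> (real w ^ 2 - 1) / 2))"
proof (intro conjI allI impI ballI)
  fix P :: "'a puzzle" and p
  assume P: "inglenook_puzzle P \<and> natural P \<and> card (wagons P) = w \<and> always_solvable P"
    and p: "p \<in> starts P"
  interpret inglenook P using P by unfold_locales simp
  obtain ps where ps: "solution P p ps" "num_moves ps \<le> 2 * w\<^sup>2 + 12 * w - 10"
    using natural_short_solution[of p w] P p by blast
  \<comment> \<open>For \<open>w > 0\<close> the sum \<open>2 * w\<^sup>2 + 12 * w\<close> exceeds
    10, so the subtraction on naturals is exact.\<close>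
  have "num_moves ps + 10 \<le> 2 * w\<^sup>2 + 12 * w" using ps(2) assms by simp
  then have "real (num_moves ps + 10) \<le> real (2 * w\<^sup>2 + 12 * w)" by (rule of_nat_mono)
  then show "\<exists>ps. solution P p ps \<and> real (num_moves ps) \<le> 2 * real w ^ 2 + 12 * real w - 10"
    using ps(1) by (intro exI[of _ ps]) simp
next
  let ?P = "reversal_puzzle w" and ?p = "[[], [0..<w], []]"
  have "?p \<in> starts ?P" "card (wagons ?P) = w" by (auto simp: reversal_puzzle_def)
  moreover have "real (num_moves ps) \<ge> (real w ^ 2 - 1) / 2" if "solution ?P ?p ps" for ps
  proof -
    have "real (w\<^sup>2) \<le> real (2 * num_moves ps)"
      using reversal_puzzle_solution[OF that] by (rule of_nat_mono)
    then show ?thesis by simp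
  qed
  ultimately show "\<exists>P :: nat puzzle.
      inglenook_puzzle P \<and> natural P \<and> card (wagons P) = w \<and> always_solvable P \<and>
      (\<exists>p\<in>starts P. \<forall>ps. solution P p ps \<longrightarrow> real (num_moves ps) \<ge> (real w ^ 2 - 1) / 2)"
    using reversal_puzzle_inglenook reversal_puzzle_natural reversal_puzzle_solvable assms
    by (intro exI[of _ ?P]) blast
qed

end
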